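(* Let $k\ge3$, $2\le s\le t$, $j=k-s+1$ and $t\ge j$, and put $h=n-s+1$ and $b=\lfloor h/t\rfloor$, so that $K_{s-1}\vee bK_t$ has $n-(h-bt)$ vertices. Then, for fixed $k,s,t$ and $n\to\infty$, $$\rho\bigl(\mathcal C_k(K_{s-1}\vee bK_t)\bigr)=\bigl(c+o(1)\bigr)\,n^{\frac{\min(s-1,\,k-1)}{k}},\qquad c=\begin{cases}\displaystyle\binom{s-1}{k-1}\Bigl(\frac{k-1}{s-1}\Bigr)^{\frac{k-1}{k}}, & j\le1,\\[2ex] \displaystyle\frac1t\binom tj\,j^{\,j/k}, & j\ge2,\end{cases}$$ and this is the maximum of $\rho(\mathcal H)$ over $\mathcal H\in\mathcal H^{(k)}_{K_{s,t}}(n)$ up to a factor $1+o(1)$. The mass $\sum_{u\in V(K_{s-1})}x_u^k$ carried by the $s-1$ dominating vertices in the Perron vector $x$ of $\mathcal C_k(K_{s-1}\vee bK_t)$ tends to $\frac{\min(s-1,k-1)}{k}$.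
   Context: All graphs are simple and finite; $\vee$ denotes the join, and $bK_t$ the disjoint union of $b$ copies of $K_t$. For a $k$-uniform hypergraph $\mathcal H$, the (adjacency-tensor) spectral radius is $$\rho(\mathcal H)=\max\Bigl\{k\sum_{F\in E(\mathcal H)}\prod_{v\in F}x_v:\ x\in\mathbb R^{V(\mathcal H)}_{\ge0},\ \sum_v x_v^k=1\Bigr\},$$ and a maximizing vector is called a (normalized) Perron vector. The shadow $\partial_2\mathcal H$ is the graph on $V(\mathcal H)$ whose edges are the pairs contained in some hyperedge. For a graph $M$, $\mathcal H^{(k)}_M(n)$ is the class of $k$-uniform hypergraphs on $n$ vertices whose shadow has no $M$ minor. For a graph $G$, $\mathcal C_k(G)$ is the $k$-uniform hypergraph on $V(G)$ whose edges are the $k$-cliques of $G$. *)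

theory Defs
  imports "HOL-Analysis.Analysis" "HOL-Library.Landau_Symbols"
begin

text \<open>A hypergraph is a pair of a vertex set and an edge set; a simple graph is a
  2-uniform hypergraph.\<close>

type_synonym 'a hypergraph = "'a set \<times> 'a set set"

abbreviation verts :: "'a hypergraph \<Rightarrow> 'a set" where "verts H \<equiv> fst H"

abbreviation edges :: "'a hypergraph \<Rightarrow> 'a set set" where "edges H \<equiv> snd H"

definition uniform_hypergraph :: "nat \<Rightarrow> 'a hypergraph \<Rightarrow> bool" where
  "uniform_hypergraph k H \<longleftrightarrow>
     finite (verts H) \<and> (\<forall>F\<in>edges H. F \<subseteq> verts H \<and> card F = k)"

abbreviation simple_graph :: "'a hypergraph \<Rightarrow> bool" where
  "simple_graph G \<equiv> uniform_hypergraph 2 G"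

definition complete_graph :: "nat \<Rightarrow> nat hypergraph" where
  "complete_graph n = ({..<n}, {e. e \<subseteq> {..<n} \<and> card e = 2})"

definition complete_bipartite :: "nat \<Rightarrow> nat \<Rightarrow> (nat + nat) hypergraph" where
  "complete_bipartite s t =
     ({..<s} <+> {..<t}, {{Inl i, Inr j} | i j. i < s \<and> j < t})"

definition graph_join :: "'a hypergraph \<Rightarrow> 'b hypergraph \<Rightarrow> ('a + 'b) hypergraph" where
  "graph_join G G' =
     (verts G <+> verts G',
      (\<lambda>e. Inl ` e) ` edges G \<union> (\<lambda>e. Inr ` e) ` edges G'
        \<union> {{Inl u, Inr v} | u v. u \<in> verts G \<and> v \<in> verts G'})"

definition graph_copies :: "nat \<Rightarrow> 'a hypergraph \<Rightarrow> (nat \<times> 'a) hypergraph" where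
  "graph_copies b G =
     ({..<b} \<times> verts G, {Pair i ` e | i e. i < b \<and> e \<in> edges G})"

definition clique_hypergraph :: "nat \<Rightarrow> 'a hypergraph \<Rightarrow> 'a hypergraph" where
  "clique_hypergraph k G =
     (verts G,
      {F. F \<subseteq> verts G \<and> card F = k \<and> (\<forall>u\<in>F. \<forall>v\<in>F. u \<noteq> v \<longrightarrow> {u, v} \<in> edges G)})"

definition shadow :: "'a hypergraph \<Rightarrow> 'a hypergraph" where
  "shadow H =
     (verts H, {{u, v} | u v. u \<noteq> v \<and> (\<exists>F\<in>edges H. u \<in> F \<and> v \<in> F)})"

definition connected_subset :: "'a hypergraph \<Rightarrow> 'a set \<Rightarrow> bool" where
  "connected_subset G B \<longleftrightarrow>
     B \<noteq> {} \<and> B \<subseteq> verts G \<and>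
     (\<forall>u\<in>B. \<forall>v\<in>B. (u, v) \<in> {(x, y). x \<in> B \<and> y \<in> B \<and> {x, y} \<in> edges G}\<^sup>*)"

text \<open>The graph \<open>M\<close> is a minor of the graph \<open>G\<close> iff \<open>G\<close> contains a model of \<open>M\<close>: disjoint
  connected branch sets, one for each vertex of \<open>M\<close>, with an edge of \<open>G\<close> between the branch
  sets of any two adjacent vertices of \<open>M\<close>.\<close>

definition has_minor :: "'a hypergraph \<Rightarrow> 'b hypergraph \<Rightarrow> bool" where
  "has_minor G M \<longleftrightarrow>
     (\<exists>B :: 'b \<Rightarrow> 'a set.
        (\<forall>p\<in>verts M. connected_subset G (B p)) \<and>
        disjoint_family_on B (verts M) \<and>
        (\<forall>p\<in>verts M. \<forall>q\<in>verts M. {p, q} \<in> edges M \<longrightarrow>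
           (\<exists>u\<in>B p. \<exists>v\<in>B q. {u, v} \<in> edges G)))"

text \<open>The class of all \<open>k\<close>-uniform hypergraphs on \<open>n\<close> vertices (taken from the type \<open>'a\<close>)
  whose shadow has no \<open>M\<close> minor.\<close>

definition minor_free_class :: "nat \<Rightarrow> 'b hypergraph \<Rightarrow> nat \<Rightarrow> 'a hypergraph set" where
  "minor_free_class k M n =
     {H. uniform_hypergraph k H \<and> card (verts H) = n \<and> \<not> has_minor (shadow H) M}"

definition tensor_form :: "nat \<Rightarrow> 'a hypergraph \<Rightarrow> ('a \<Rightarrow> real) \<Rightarrow> real" where
  "tensor_form k H x = real k * (\<Sum>F\<in>edges H. \<Prod>v\<in>F. x v)"

text \<open>Vectors indexed by the vertices are functions on the whole type; values outside the vertex
  set are irrelevant.\<close>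

definition unit_vector :: "nat \<Rightarrow> 'a hypergraph \<Rightarrow> ('a \<Rightarrow> real) \<Rightarrow> bool" where
  "unit_vector k H x \<longleftrightarrow> (\<forall>v\<in>verts H. 0 \<le> x v) \<and> (\<Sum>v\<in>verts H. x v ^ k) = 1"

text \<open>The supremum is a maximum if there is a vertex; see \<open>spectral_radius_attained\<close> below.\<close>

definition spectral_radius :: "nat \<Rightarrow> 'a hypergraph \<Rightarrow> real" where
  "spectral_radius k H = (SUP x\<in>{x. unit_vector k H x}. tensor_form k H x)"

definition perron_vector :: "nat \<Rightarrow> 'a hypergraph \<Rightarrow> ('a \<Rightarrow> real) \<Rightarrow> bool" where
  "perron_vector k H x \<longleftrightarrow> is_arg_max (tensor_form k H) (unit_vector k H) x"

lemma spectral_radius_perron_vector: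
  assumes "perron_vector k H x"
  shows "spectral_radius k H = tensor_form k H x"
  unfolding spectral_radius_def
  using assms
  by (intro cSup_eq_maximum) (auto simp: perron_vector_def is_arg_max_def not_less)

lemma perron_vector_exists:
  assumes H: "uniform_hypergraph k H" and ne: "verts H \<noteq> {}" and k: "k > 0"
  shows "\<exists>x. perron_vector k H x"
proof -
  define V where "V = verts H"
  have fin: "finite V" and sub: "\<And>F. F \<in> edges H \<Longrightarrow> F \<subseteq> V"
    using H by (auto simp: uniform_hypergraph_def V_def)
  define S :: "('a \<Rightarrow> real) set"
    where "S = (\<Pi>\<^sub>E v\<in>UNIV. if v \<in> V then {0..1} else {0}) \<inter> {x. (\<Sum>v\<in>V. x v ^ k) = 1}"
  have "compactin (product_topology (\<lambda>v::'a. euclidean :: real topology) UNIV)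
          (\<Pi>\<^sub>E v\<in>UNIV. if v \<in> V then {0..1} else {0})"
    by (subst compactin_PiE) auto
  then have "compact (\<Pi>\<^sub>E v\<in>UNIV. if v \<in> V then {0..1} else {0::real})"
    by (simp add: euclidean_product_topology)
  moreover have "closed {x :: 'a \<Rightarrow> real. (\<Sum>v\<in>V. x v ^ k) = 1}"
    by (intro closed_Collect_eq continuous_intros continuous_on_product_coordinates)
  ultimately have compact: "compact S"
    unfolding S_def by (rule compact_Int_closed)
  have "continuous_on S (tensor_form k H)"
    unfolding tensor_form_def
    by (intro continuous_intros continuous_on_product_then_coordinatewise continuous_on_id)
  moreover obtain w where w: "w \<in> V"
    using ne by (auto simp: V_def)
  have "(\<Sum>v\<in>V. (if v = w then 1 else 0 :: real) ^ k) = (\<Sum>v\<in>V. if v = w then 1 else 0)"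
    using k by (intro sum.cong) auto
  then have "(\<lambda>v. if v = w then 1 else 0) \<in> S"
    using w fin by (auto simp: S_def PiE_def)
  ultimately obtain x where x: "x \<in> S"
    and max: "\<And>y. y \<in> S \<Longrightarrow> tensor_form k H y \<le> tensor_form k H x"
    using continuous_attains_sup[OF compact] by blast
  have "unit_vector k H x"
    using x by (fastforce simp: S_def unit_vector_def V_def PiE_def Pi_def split: if_splits)
  moreover have "tensor_form k H y \<le> tensor_form k H x" if y: "unit_vector k H y" for y
  proof -
    define z where "z = (\<lambda>v. if v \<in> V then y v else 0)"
    have ge: "0 \<le> y v" if "v \<in> V" for v
      using y that by (auto simp: unit_vector_def V_def)
    have sum1: "(\<Sum>v\<in>V. y v ^ k) = 1"
      using y by (auto simp: unit_vector_def V_def)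
    have "y v \<le> 1" if v: "v \<in> V" for v
    proof -
      have "y v ^ k \<le> (\<Sum>v\<in>V. y v ^ k)"
        using ge by (intro member_le_sum v fin) auto
      then show ?thesis
        using sum1 k ge[OF v] by (simp add: power_le_one_iff)
    qed
    moreover have "(\<Sum>v\<in>V. z v ^ k) = 1"
      unfolding sum1[symmetric] z_def by (intro sum.cong) auto
    ultimately have "z \<in> S"
      using ge by (auto simp: S_def z_def PiE_def)
    moreover have "tensor_form k H z = tensor_form k H y"
      unfolding tensor_form_def z_def using sub
      by (intro arg_cong2[where f = "(*)"] sum.cong prod.cong refl) auto
    ultimately show ?thesis
      using max[of z] by simp
  qed
  ultimately show ?thesis
    by (auto simp: perron_vector_def is_arg_max_def not_less)
qed

lemma spectral_radius_attained:
  assumes "uniform_hypergraph k H" "verts H \<noteq> {}" "k > 0"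
  shows "\<exists>x. unit_vector k H x \<and> tensor_form k H x = spectral_radius k H \<and>
             (\<forall>y. unit_vector k H y \<longrightarrow> tensor_form k H y \<le> spectral_radius k H)"
  using perron_vector_exists[OF assms]
  by (metis spectral_radius_perron_vector perron_vector_def is_arg_max_def not_less)

lemma spectral_radius_rename:
  fixes f :: "'a \<Rightarrow> 'b"
  assumes inj: "inj_on f (verts H)" and sub: "\<And>F. F \<in> edges H \<Longrightarrow> F \<subseteq> verts H"
  shows "spectral_radius k (f ` verts H, (`) f ` edges H) = spectral_radius k H"
proof -
  let ?H = "(f ` verts H, (`) f ` edges H)"
  have inj': "inj_on f F" if "F \<in> edges H" for F
    using inj sub[OF that] by (rule inj_on_subset)
  have "inj_on ((`) f) (edges H)"
    using inj sub by (meson inj_onI inj_on_image_eq_iff)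
  then have form: "tensor_form k ?H x = tensor_form k H (x \<circ> f)" for x
    by (simp add: tensor_form_def sum.reindex prod.reindex inj')
  have unit: "unit_vector k ?H x \<longleftrightarrow> unit_vector k H (x \<circ> f)" for x
    by (simp add: unit_vector_def sum.reindex inj)
  have "tensor_form k ?H ` {x. unit_vector k ?H x} = tensor_form k H ` {x. unit_vector k H x}"
  proof (intro equalityI subsetI)
    fix r assume "r \<in> tensor_form k H ` {x. unit_vector k H x}"
    then obtain x where x: "unit_vector k H x" "r = tensor_form k H x" by auto
    define y where "y = x \<circ> inv_into (verts H) f"
    have y: "(y \<circ> f) v = x v" if "v \<in> verts H" for v
      using that inj by (simp add: y_def)
    have "unit_vector k H (y \<circ> f)"
      using x(1) y unfolding unit_vector_def by (metis (no_types, lifting) sum.cong)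
    moreover have "tensor_form k H (y \<circ> f) = r"
      unfolding x(2) tensor_form_def using sub y
      by (intro arg_cong2[where f = "(*)"] sum.cong prod.cong refl) blast
    ultimately show "r \<in> tensor_form k ?H ` {x. unit_vector k ?H x}"
      unfolding form[abs_def] unit by blast
  qed (auto simp: form unit)
  then show ?thesis
    by (simp add: spectral_radius_def)
qed

lemma finite_spectral_radius_minor_free_class:
  "finite (spectral_radius k ` (minor_free_class k M n :: 'a hypergraph set))"
proof (rule finite_subset)
  show "spectral_radius k ` (minor_free_class k M n :: 'a hypergraph set)
          \<subseteq> spectral_radius k ` ({{..<n}} \<times> Pow (Pow {..<n}))"
  proof (intro image_subsetI)
    fix H :: "'a hypergraph" assume "H \<in> minor_free_class k M n"
    then have fin: "finite (verts H)" and card: "card (verts H) = n"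
      and sub: "\<And>F. F \<in> edges H \<Longrightarrow> F \<subseteq> verts H"
      by (auto simp: minor_free_class_def uniform_hypergraph_def)
    obtain f where f: "bij_betw f (verts H) {..<n}"
      using fin card by (metis atLeast0LessThan ex_bij_betw_finite_nat)
    let ?H = "(f ` verts H, (`) f ` edges H)"
    have "spectral_radius k H = spectral_radius k ?H"
      using spectral_radius_rename[of f H k] f sub by (simp add: bij_betw_def)
    moreover have "?H \<in> {{..<n}} \<times> Pow (Pow {..<n})"
      using f sub by (fastforce simp: bij_betw_def)
    ultimately show "spectral_radius k H \<in> spectral_radius k ` ({{..<n}} \<times> Pow (Pow {..<n}))"
      by (metis imageI)
  qed
qed simp

text \<open>The dominating vertices, those of the factor \<open>K\<^bsub>s-1\<^esub>\<close>, are the ones in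
  \<open>Inl ` {..<s - 1}\<close>. For \<open>s \<le> n + 1\<close> the natural number \<open>n + 1 - s\<close> is \<open>h = n - s + 1\<close>.\<close>

definition extremal_graph :: "nat \<Rightarrow> nat \<Rightarrow> nat \<Rightarrow> (nat + nat \<times> nat) hypergraph" where
  "extremal_graph s t n =
     (let h = n + 1 - s; b = h div t
      in graph_join (complete_graph (s - 1)) (graph_copies b (complete_graph t)))"

lemma card_verts_extremal_graph:
  assumes "1 \<le> s" "s \<le> n + 1"
  shows "card (verts (extremal_graph s t n)) = n - ((n + 1 - s) - (n + 1 - s) div t * t)"
proof -
  have "(n + 1 - s) div t * t \<le> n + 1 - s" by simp
  then show ?thesis
    using assms
    by (simp add: extremal_graph_def graph_join_def graph_copies_def complete_graph_def
        card_Plus Let_def del: div_times_less_eq_dividend)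
qed

lemma simple_graph_extremal_graph: "simple_graph (extremal_graph s t n)"
proof -
  have complete: "simple_graph (complete_graph m)" for m
    by (auto simp: uniform_hypergraph_def complete_graph_def)
  have copies: "simple_graph (graph_copies b G)" if "simple_graph G"
    for b and G :: "'b hypergraph"
    using that
    by (fastforce simp: uniform_hypergraph_def graph_copies_def card_image inj_on_def)
  have join: "simple_graph (graph_join G G')" if "simple_graph G" "simple_graph G'"
    for G :: "'b hypergraph" and G' :: "'c hypergraph"
    using that
    by (fastforce simp: uniform_hypergraph_def graph_join_def card_image)
  show ?thesis
    by (simp add: extremal_graph_def Let_def complete copies join)
qed

end

theory Submission
  imports Defs
begin

text \<open>The exponent comes from cliques with \<open>r - 1\<close> vertices of constant weight
  and \<open>m\<close> of weight about \<open>n powr (- 1 / k)\<close>: there are linearly many,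
  which gives \<open>n powr (1 - m / k)\<close>. The obstacle is that the set \<open>L\<close> of
  large weights depends on the vector, while the weights outside it may be spread over all scales.
  Hence the threshold is fixed before \<open>n\<close>, so that everything attached to
  \<open>L\<close> stays bounded, and the other scales are handled by dyadic levels. Minors enter
  only through the estimates collected in \<open>sparse\<close>, which speak of cliques and common
  neighbours; the analysis never sees a branch set. The lower bound comes from a vector that is
  constant on each of the two parts of the extremal graph. That graph attains all the local counts
  at once, and this vector is the equality case of the weighted inequality. The two cases of the
  constant are one formula: \<open>m\<close> is the maximum of 1 and j, and for \<open>m = 1\<close>
  the second binomial coefficient in \<open>\<Delta>\<close> is 1.\<close>

text \<open>For the upper bound, let \<open>L\<close> be the set of vertices of weight at least a small constant.
  A \<open>K\<^bsub>s,t\<^esub>\<close>-minor-free graph is degenerate, hence has linearly many cliques, and an \<open>s\<close>-set has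
  fewer than \<open>t\<close> common neighbours. So only boundedly many cliques meet \<open>L\<close> in \<open>r = min s k\<close>
  or more vertices, and a dyadic decomposition by weight shows that the cliques meeting \<open>L\<close> in
  fewer than \<open>r - 1\<close> vertices contribute a small multiple of \<open>n powr ((r - 1) / k)\<close>. In a
  remaining clique, \<open>r - 1\<close> vertices lie in \<open>L\<close> and the other \<open>m = k - r + 1\<close> outside. Outside a
  bounded set a vertex has at most \<open>s - 1\<close> neighbours in \<open>L\<close>, and at most \<open>t - 1\<close> neighbours with
  the same \<open>s - 1\<close> neighbours in \<open>L\<close>, which bounds the number of such cliques through each vertex;
  the weighted arithmetic-geometric mean inequality applied to each clique then gives the sharp
  constant. Moving the weights of that inequality off their optimum shows that the mass of the
  dominating vertices cannot stay away from \<open>(r - 1) / k\<close> in the extremal graph.\<close>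

subsection \<open>Dense graphs contain clique minors\<close>

definition connected_in :: "('a \<Rightarrow> 'a \<Rightarrow> bool) \<Rightarrow> 'a set \<Rightarrow> bool" where
  "connected_in adj B \<longleftrightarrow>
     B \<noteq> {} \<and> (\<forall>u\<in>B. \<forall>v\<in>B. (u, v) \<in> {(x, y). x \<in> B \<and> y \<in> B \<and> adj x y}\<^sup>*)"

definition degree_in :: "('a \<Rightarrow> 'a \<Rightarrow> bool) \<Rightarrow> 'a set \<Rightarrow> 'a \<Rightarrow> nat" where
  "degree_in adj X v = card {u \<in> X. adj v u}"

text \<open>For symmetric irreflexive \<open>adj\<close> this is twice the number of edges inside
  \<open>X\<close>; keeping the factor 2 avoids division.\<close>

definition degree_sum :: "('a \<Rightarrow> 'a \<Rightarrow> bool) \<Rightarrow> 'a set \<Rightarrow> nat" where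
  "degree_sum adj X = (\<Sum>v\<in>X. degree_in adj X v)"

definition boundary :: "('a \<Rightarrow> 'a \<Rightarrow> bool) \<Rightarrow> 'a set \<Rightarrow> 'a set \<Rightarrow> 'a set" where
  "boundary adj V U = {v \<in> V - U. \<exists>u\<in>U. adj u v}"

lemma degree_sum_remove:
  assumes "symp adj" "irreflp adj" "finite X" "y \<in> X"
  shows "degree_sum adj X = degree_sum adj (X - {y}) + 2 * degree_in adj X y"
proof -
  let ?Y = "X - {y}"
  have deg: "degree_in adj X v = degree_in adj ?Y v + of_bool (adj v y)" for v
  proof -
    have "{u \<in> X. adj v u} = {u \<in> ?Y. adj v u} \<union> (if adj v y then {y} else {})"
      using assms(4) by auto
    then show ?thesis
      using assms(3) by (auto simp: degree_in_def card_insert_if)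
  qed
  have "(\<Sum>v\<in>?Y. of_bool (adj v y)) = degree_in adj X y"
    using assms
    by (auto simp: degree_in_def sum.If_cases of_bool_def symp_def irreflp_def
        intro!: arg_cong[where f = card])
  moreover have "degree_sum adj X = degree_in adj X y + (\<Sum>v\<in>?Y. degree_in adj X v)"
    using assms by (simp add: degree_sum_def sum.remove)
  ultimately show ?thesis
    by (simp add: deg sum.distrib degree_sum_def)
qed

lemma connected_in_insert:
  assumes U: "connected_in adj U" and "symp adj" and u: "u \<in> U" "adj u y"
  shows "connected_in adj (insert y U)"
proof -
  let ?R = "\<lambda>B. {(x, z). x \<in> B \<and> z \<in> B \<and> adj x z}"
  have mono: "(?R U)\<^sup>* \<subseteq> (?R (insert y U))\<^sup>*"
    by (intro rtrancl_mono) auto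
  have yu: "(u, y) \<in> (?R (insert y U))\<^sup>*" "(y, u) \<in> (?R (insert y U))\<^sup>*"
    using u \<open>symp adj\<close> by (auto simp: symp_def)
  have "(v, u) \<in> (?R (insert y U))\<^sup>* \<and> (u, v) \<in> (?R (insert y U))\<^sup>*" if "v \<in> insert y U" for v
    using that yu U u(1) mono unfolding connected_in_def by blast
  then show ?thesis
    unfolding connected_in_def by (blast intro: rtrancl_trans)
qed

text \<open>Moving \<open>y\<close> into \<open>U\<close> takes \<open>y\<close> out of the boundary
  and adds those neighbours of \<open>y\<close> outside \<open>U\<close> that were not yet in it.
  The additive form avoids subtraction of naturals.\<close>

lemma boundary_insert:
  assumes "symp adj" "irreflp adj" "finite V" "y \<in> boundary adj V U"
  shows "card (boundary adj V (insert y U)) + 1 + degree_in adj (boundary adj V U) y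
           = card (boundary adj V U) + degree_in adj (V - U) y"
proof -
  let ?G = "boundary adj V U" and ?N = "{v \<in> V - U. adj y v}"
  have fin: "finite ?G" "finite ?N"
    using assms(3) by (auto simp: boundary_def)
  have "boundary adj V (insert y U) = (?G - {y}) \<union> (?N - ?G)"
    using assms(2,4) by (auto simp: boundary_def irreflp_def)
  also have "card \<dots> = card (?G - {y}) + card (?N - ?G)"
    using fin by (intro card_Un_disjoint) auto
  finally have "card (boundary adj V (insert y U)) = card (?G - {y}) + card (?N - ?G)" .
  moreover have "card (?G - {y}) + 1 = card ?G"
    using card_Suc_Diff1[OF fin(1) assms(4)] by simp
  moreover have "degree_in adj ?G y = card (?N \<inter> ?G)"
    unfolding degree_in_def by (intro arg_cong[where f = card]) (auto simp: boundary_def)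
  moreover have "degree_in adj (V - U) y = card (?N \<inter> ?G) + card (?N - ?G)"
    unfolding degree_in_def by (rule card_Int_Diff[OF fin(2)])
  ultimately show ?thesis
    by linarith
qed

lemma boundary_singleton:
  assumes "irreflp adj" "w \<in> V"
  shows "card (boundary adj V {w}) = degree_in adj V w"
  using assms unfolding boundary_def degree_in_def irreflp_def
  by (intro arg_cong[where f = card]) auto

text \<open>Below, \<open>good U\<close> says that the graph obtained by contracting the connected set \<open>U\<close> has at
  least \<open>d\<close> times as many edges as vertices.\<close>

lemma dense_neighbourhood_of_connected_set:
  assumes adj: "symp adj" "irreflp adj" and V: "finite V" "V \<noteq> {}" and d: "d > 0"
    and dense: "2 * d * card V \<le> degree_sum adj V"
  obtains U G where "connected_in adj U" "U \<subseteq> V" "G \<subseteq> V" "G \<noteq> {}" "U \<inter> G = {}"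
    "\<And>v. v \<in> G \<Longrightarrow> \<exists>u\<in>U. adj u v" "d * card G \<le> degree_sum adj G"
proof -
  define P where "P X \<longleftrightarrow> X \<subseteq> V \<and> X \<noteq> {} \<and> 2 * d * card X \<le> degree_sum adj X" for X
  have "P V"
    using assms by (simp add: P_def)
  \<comment> \<open>In a smallest dense set, deleting a nonempty part never leaves a nonempty dense
    set.\<close>
  then obtain X where X: "P X" and least: "\<And>Y. P Y \<Longrightarrow> card X \<le> card Y"
    by (metis ex_has_least_nat)
  have finX: "finite X"
    using X V by (auto simp: P_def intro: finite_subset)
  \<comment> \<open>The contraction has the vertices of \<open>X - U\<close> and one more for
    \<open>U\<close>, and its edges are those inside \<open>X - U\<close> and one for each boundary
    vertex. Both sides are doubled to match \<open>degree_sum\<close>.\<close>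
  define good where
    "good U \<longleftrightarrow> U \<subseteq> X \<and> connected_in adj U \<and>
       2 * d * (card (X - U) + 1) \<le> degree_sum adj (X - U) + 2 * card (boundary adj X U)" for U
  obtain w where w: "w \<in> X"
    using X by (auto simp: P_def)
  have "card X = card (X - {w}) + 1"
    using w finX by (metis Suc_eq_plus1 card_Suc_Diff1)
  then have "good {w}"
    using X w degree_sum_remove[OF adj finX w] boundary_singleton[OF adj(2) w]
    by (auto simp: good_def P_def connected_in_def)
  moreover have "card U < Suc (card X)" if "good U" for U
    using that finX by (simp add: good_def card_mono less_Suc_eq_le)
  ultimately obtain U where U: "good U" and greatest: "\<And>U'. good U' \<Longrightarrow> card U' \<le> card U"
    using ex_has_greatest_nat[of good "{w}" card "Suc (card X)"] by blast
  define G where "G = boundary adj X U"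
  have finU: "finite U"
    using U finX by (auto simp: good_def intro: finite_subset)
  have finG: "finite G"
    using finX by (auto simp: G_def boundary_def)
  \<comment> \<open>With empty boundary the contracted vertex would be isolated. Then
    \<open>X - U\<close> is either dense, against minimality of \<open>X\<close>, or empty, against
    \<open>d > 0\<close>.\<close>
  have "G \<noteq> {}"
  proof
    assume "G = {}"
    then have *: "2 * d * (card (X - U) + 1) \<le> degree_sum adj (X - U)"
      using U by (simp add: good_def G_def)
    show False
    proof (cases "X - U = {}")
      case True
      then show False
        using * d unfolding True by (simp add: degree_sum_def)
    next
      case False
      have "P (X - U)"
        using * X False by (auto simp: P_def algebra_simps)
      moreover have "card (X - U) < card X"
        using U finX by (intro psubset_card_mono) (auto simp: good_def connected_in_def)
      ultimately show False
        using least by fastforce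
    qed
  qed
  \<comment> \<open>Otherwise absorbing \<open>y\<close> into \<open>U\<close> costs the contraction
    one vertex and \<open>degree_in adj G y + 1 \<le> d\<close> edges, so the larger set is still
    good, against maximality of \<open>U\<close>.\<close>
  moreover have "d \<le> degree_in adj G y" if y: "y \<in> G" for y
  proof (rule ccontr)
    assume "\<not> d \<le> degree_in adj G y"
    then have less: "degree_in adj G y + 1 \<le> d" by simp
    have yXU: "y \<in> X - U"
      using y by (auto simp: G_def boundary_def)
    have minus: "X - insert y U = X - U - {y}" by blast
    have "card (X - U) = card (X - insert y U) + 1"
      unfolding minus using card_Suc_Diff1[OF _ yXU] finX by simp
    moreover have "degree_sum adj (X - U) =
        degree_sum adj (X - insert y U) + 2 * degree_in adj (X - U) y"
      unfolding minus using finX yXU by (intro degree_sum_remove adj) auto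
    moreover have "card (boundary adj X (insert y U)) + 1 + degree_in adj G y
           = card G + degree_in adj (X - U) y"
      unfolding G_def using y finX by (intro boundary_insert adj) (auto simp: G_def)
    moreover have "2 * d * (card (X - U) + 1) \<le> degree_sum adj (X - U) + 2 * card G"
      using U by (simp add: good_def G_def)
    ultimately have "2 * d * (card (X - insert y U) + 1)
        \<le> degree_sum adj (X - insert y U) + 2 * card (boundary adj X (insert y U))"
      using less by (simp add: distrib_left)
    moreover have "connected_in adj (insert y U)"
      using U y adj(1) by (auto simp: good_def G_def boundary_def intro: connected_in_insert)
    ultimately have "good (insert y U)"
      using U yXU by (simp add: good_def)
    then show False
      using greatest[of "insert y U"] yXU finU by simp
  qed
  then have "d * card G \<le> degree_sum adj G"
    using sum_bounded_below[of G d "degree_in adj G"] by (simp add: degree_sum_def mult.commute)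
  moreover have "connected_in adj U" "U \<subseteq> V" "G \<subseteq> V" "U \<inter> G = {}"
    "\<And>v. v \<in> G \<Longrightarrow> \<exists>u\<in>U. adj u v"
    using U X by (auto simp: good_def P_def G_def boundary_def)
  ultimately show thesis
    using that by blast
qed

text \<open>Mader's induction: the connected set \<open>U\<close> becomes a branch set adjacent to
  all later ones, because these are found inside its neighbourhood. Passing to the neighbourhood
  halves the density, hence the power of two.\<close>

lemma clique_model_of_dense:
  assumes adj: "symp adj" "irreflp adj" and "finite V" "V \<noteq> {}"
    and "2 ^ (r + 1) * card V \<le> degree_sum adj V"
  shows "\<exists>B :: nat \<Rightarrow> 'a set. (\<forall>i<r. connected_in adj (B i) \<and> B i \<subseteq> V) \<and>
           (\<forall>i<r. \<forall>j<r. i \<noteq> j \<longrightarrow> B i \<inter> B j = {} \<and> (\<exists>u\<in>B i. \<exists>v\<in>B j. adj u v))"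
  using assms(3-5)
proof (induction r arbitrary: V)
  case (Suc r)
  have "2 * 2 ^ (r + 1) * card V \<le> degree_sum adj V"
    using Suc.prems(3) by (simp add: mult.assoc)
  then obtain U G where UG: "connected_in adj U" "U \<subseteq> V" "G \<subseteq> V" "G \<noteq> {}" "U \<inter> G = {}"
    "\<And>v. v \<in> G \<Longrightarrow> \<exists>u\<in>U. adj u v" "2 ^ (r + 1) * card G \<le> degree_sum adj G"
    using dense_neighbourhood_of_connected_set[OF adj Suc.prems(1,2)]
    by (metis zero_less_numeral zero_less_power)
  obtain B :: "nat \<Rightarrow> 'a set" where B: "\<forall>i<r. connected_in adj (B i) \<and> B i \<subseteq> G"
    "\<forall>i<r. \<forall>j<r. i \<noteq> j \<longrightarrow> B i \<inter> B j = {} \<and> (\<exists>u\<in>B i. \<exists>v\<in>B j. adj u v)"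
    using Suc.IH[OF finite_subset[OF UG(3) Suc.prems(1)] UG(4,7)] by blast
  have ne: "U \<noteq> {}" "\<And>i. i < r \<Longrightarrow> B i \<noteq> {}"
    using UG(1) B(1) by (auto simp: connected_in_def)
  have edge: "\<exists>u\<in>U. \<exists>v\<in>B i. adj u v" "\<exists>u\<in>B i. \<exists>v\<in>U. adj u v" if i: "i < r" for i
  proof -
    obtain v where "v \<in> B i" "v \<in> G"
      using ne(2)[OF i] B(1) i by blast
    then show "\<exists>u\<in>U. \<exists>v\<in>B i. adj u v" "\<exists>u\<in>B i. \<exists>v\<in>U. adj u v"
      using UG(6) adj(1) by (auto simp: symp_def) blast+
  qed
  have disj: "B i \<inter> U = {}" "U \<inter> B i = {}" if "i < r" for i
    using that B(1) UG(5) by blast+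
  show ?case
  proof (intro exI[of _ "B(r := U)"] conjI allI impI)
    fix i j assume ij: "i < Suc r" "j < Suc r" "i \<noteq> j"
    show "(B(r := U)) i \<inter> (B(r := U)) j = {}"
      using ij B(2) disj by (cases "i = r"; cases "j = r") simp_all
    show "\<exists>u\<in>(B(r := U)) i. \<exists>v\<in>(B(r := U)) j. adj u v"
      using ij B(2) edge by (cases "i = r"; cases "j = r") simp_all
  qed (use B(1) UG in \<open>auto simp: less_Suc_eq\<close>)
qed simp

subsection \<open>Counting cliques\<close>

definition cliques :: "('a \<Rightarrow> 'a \<Rightarrow> bool) \<Rightarrow> 'a set \<Rightarrow> nat \<Rightarrow> 'a set set" where
  "cliques adj X k = {F. F \<subseteq> X \<and> card F = k \<and> (\<forall>u\<in>F. \<forall>v\<in>F. u \<noteq> v \<longrightarrow> adj u v)}"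

lemma finite_cliques: "finite X \<Longrightarrow> finite (cliques adj X k)"
  by (rule finite_subset[of _ "Pow X"]) (auto simp: cliques_def)

definition common_nbrs :: "('a \<Rightarrow> 'a \<Rightarrow> bool) \<Rightarrow> 'a set \<Rightarrow> 'a set \<Rightarrow> 'a set" where
  "common_nbrs adj X A = {v \<in> X. \<forall>u\<in>A. adj u v}"

text \<open>The hypothesis yields a vertex of degree at most \<open>D\<close>. A clique through it
  is determined by a subset of its neighbours, so removing it loses at most \<open>2 ^ D\<close>
  cliques.\<close>

lemma card_cliques_degenerate:
  assumes "finite X" "k > 0"
    and "\<And>Y. Y \<subseteq> X \<Longrightarrow> Y \<noteq> {} \<Longrightarrow> degree_sum adj Y \<le> D * card Y"
  shows "card (cliques adj X k) \<le> 2 ^ D * card X"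
  using assms(1,3)
proof (induction "card X" arbitrary: X)
  case 0
  then show ?case
    using \<open>k > 0\<close> by (auto simp: cliques_def)
next
  case (Suc n)
  have ne: "X \<noteq> {}" using Suc.hyps(2) by auto
  have "\<exists>v\<in>X. degree_in adj X v \<le> D"
  proof (rule ccontr)
    assume "\<not> ?thesis"
    then have "(\<Sum>v\<in>X. D) < degree_sum adj X"
      unfolding degree_sum_def using Suc.prems(1) ne by (intro sum_strict_mono) auto
    then show False
      using Suc.prems(2)[of X] ne by (simp add: mult.commute)
  qed
  then obtain v where v: "v \<in> X" "degree_in adj X v \<le> D" by blast
  let ?N = "{u \<in> X. adj v u}" and ?Y = "X - {v}"
  have "cliques adj X k \<subseteq> cliques adj ?Y k \<union> insert v ` Pow ?N"
  proof
    fix F assume F: "F \<in> cliques adj X k"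
    show "F \<in> cliques adj ?Y k \<union> insert v ` Pow ?N"
    proof (cases "v \<in> F")
      case True
      then have "F - {v} \<in> Pow ?N" "F = insert v (F - {v})"
        using F by (auto simp: cliques_def)
      then show ?thesis by blast
    qed (use F in \<open>auto simp: cliques_def\<close>)
  qed
  then have "card (cliques adj X k) \<le> card (cliques adj ?Y k \<union> insert v ` Pow ?N)"
    using Suc.prems(1) by (intro card_mono) (auto simp: finite_cliques)
  also have "\<dots> \<le> card (cliques adj ?Y k) + card (insert v ` Pow ?N)"
    by (rule card_Un_le)
  also have "card (insert v ` Pow ?N) \<le> card (Pow ?N)"
    using Suc.prems(1) by (intro card_image_le) auto
  also have "card (Pow ?N) \<le> 2 ^ D"
    using v Suc.prems(1) by (simp add: card_Pow degree_in_def)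
  also have "card (cliques adj ?Y k) \<le> 2 ^ D * card ?Y"
    using Suc.hyps(2) v(1) Suc.prems by (intro Suc.hyps(1)) auto
  finally have "card (cliques adj X k) \<le> 2 ^ D * (card ?Y + 1)"
    by (simp add: algebra_simps)
  also have "card ?Y + 1 = card X"
    using v(1) Suc.prems(1) by (metis Suc_eq_plus1 card_Suc_Diff1)
  finally show ?case .
qed

subsection \<open>Weighting the cliques by the arithmetic-geometric mean inequality\<close>

text \<open>The arithmetic-geometric mean inequality for the numbers \<open>y v ^ card F\<close>,
  whose geometric mean is the product.\<close>

lemma card_mult_prod_le_sum_power:
  fixes y :: "'a \<Rightarrow> real"
  assumes F: "finite F" "F \<noteq> {}" and y: "\<And>v. v \<in> F \<Longrightarrow> 0 \<le> y v"
  shows "real (card F) * (\<Prod>v\<in>F. y v) \<le> (\<Sum>v\<in>F. y v ^ card F)"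
proof -
  let ?k = "card F"
  have k: "?k > 0" using F by (simp add: card_gt_0_iff)
  have p: "0 \<le> (\<Prod>v\<in>F. y v)" using y by (rule prod_nonneg)
  have "(\<Prod>v\<in>F. y v) = ((\<Prod>v\<in>F. y v) ^ ?k) powr (1 / ?k)"
    using k p by (cases "(\<Prod>v\<in>F. y v) = 0") (simp_all add: powr_powr flip: powr_realpow)
  also have "\<dots> = (\<Prod>v\<in>F. y v ^ ?k) powr (1 / ?k)"
    by (simp add: prod_power_distrib)
  also have "\<dots> \<le> (\<Sum>v\<in>F. y v ^ ?k / ?k)"
    using F y by (intro arith_geom_mean) auto
  finally show ?thesis
    using k by (simp add: field_simps flip: sum_divide_distrib)
qed

lemma powr_divide_power: "0 < z \<Longrightarrow> (z powr (1 / real k)) ^ j = z powr (real j / real k)"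
  for z :: real
  by (simp add: powr_powr flip: powr_realpow)

text \<open>The weights on \<open>W\<close> are scaled by \<open>\<beta>\<close> before the
  arithmetic-geometric mean inequality is applied to each member of \<open>FF\<close>. Every product
  then gains at least \<open>\<beta> ^ m\<close>, and in the sum of the upper bounds a vertex occurs
  once for each member through it, at most \<open>a\<close> or \<open>b\<close> times. The condition
  on powers of \<open>\<beta>\<close> covers both exactly \<open>m\<close> vertices in
  \<open>W\<close> and, for \<open>\<beta> \<ge> 1\<close>, at least \<open>m\<close>.\<close>

lemma weighted_sum_prod_le:
  fixes x :: "'a \<Rightarrow> real" and \<beta> a b :: real
  assumes fin: "finite L" "finite W" and disj: "L \<inter> W = {}"
    and x: "\<And>v. v \<in> L \<union> W \<Longrightarrow> 0 \<le> x v" and k: "k > 0" and \<beta>: "\<beta> > 0"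
    and FF: "\<And>F. F \<in> FF \<Longrightarrow> F \<subseteq> L \<union> W \<and> card F = k \<and> \<beta> ^ m \<le> \<beta> ^ card (F \<inter> W)"
    and a: "\<And>u. u \<in> L \<Longrightarrow> card {F \<in> FF. u \<in> F} \<le> a"
    and b: "\<And>v. v \<in> W \<Longrightarrow> card {F \<in> FF. v \<in> F} \<le> b"
  shows "\<beta> ^ m * (k * (\<Sum>F\<in>FF. \<Prod>v\<in>F. x v)) \<le> a * (\<Sum>u\<in>L. x u ^ k) + \<beta> ^ k * b * (\<Sum>v\<in>W. x v ^ k)"
proof -
  define y where "y v = (if v \<in> W then \<beta> * x v else x v)" for v
  have finFF: "finite FF"
    using fin FF by (intro finite_subset[of FF "Pow (L \<union> W)"]) auto
  have y0: "0 \<le> y v" if "v \<in> L \<union> W" for v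
    using x[OF that] \<beta> by (simp add: y_def)
  have "\<beta> ^ m * (k * (\<Prod>v\<in>F. x v)) \<le> (\<Sum>v\<in>F. y v ^ k)" if F: "F \<in> FF" for F
  proof -
    have finF: "finite F"
      using FF[OF F] fin by (auto intro: finite_subset)
    have x0: "0 \<le> (\<Prod>v\<in>F. x v)"
      using FF[OF F] x by (intro prod_nonneg) auto
    have "(\<Prod>v\<in>F. y v) = (\<Prod>v\<in>F. (if v \<in> W then \<beta> else 1) * x v)"
      by (intro prod.cong) (auto simp: y_def)
    also have "\<dots> = \<beta> ^ card (F \<inter> W) * (\<Prod>v\<in>F. x v)"
      using finF by (simp add: prod.distrib prod.If_cases Int_def)
    finally have "\<beta> ^ m * (\<Prod>v\<in>F. x v) \<le> (\<Prod>v\<in>F. y v)"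
      using FF[OF F] x0 by (simp add: mult_right_mono)
    then have "\<beta> ^ m * (k * (\<Prod>v\<in>F. x v)) \<le> k * (\<Prod>v\<in>F. y v)"
      by (metis mult.left_commute mult_left_mono of_nat_0_le_iff)
    also have "\<dots> \<le> (\<Sum>v\<in>F. y v ^ k)"
      using card_mult_prod_le_sum_power[of F y] FF[OF F] y0 finF k by fastforce
    finally show ?thesis .
  qed
  then have "(\<Sum>F\<in>FF. \<beta> ^ m * (k * (\<Prod>v\<in>F. x v))) \<le> (\<Sum>F\<in>FF. \<Sum>v\<in>F. y v ^ k)"
    by (intro sum_mono)
  also have "\<dots> = (\<Sum>F\<in>FF. \<Sum>v\<in>{v \<in> L \<union> W. v \<in> F}. y v ^ k)"
    using FF by (intro sum.cong refl) auto
  also have "\<dots> = (\<Sum>v\<in>L \<union> W. \<Sum>F\<in>{F \<in> FF. v \<in> F}. y v ^ k)"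
    using fin finFF by (intro sum.swap_restrict) auto
  also have "\<dots> = (\<Sum>v\<in>L \<union> W. real (card {F \<in> FF. v \<in> F}) * y v ^ k)"
    by simp
  also have "\<dots> = (\<Sum>u\<in>L. real (card {F \<in> FF. u \<in> F}) * y u ^ k)
      + (\<Sum>v\<in>W. real (card {F \<in> FF. v \<in> F}) * y v ^ k)"
    using fin disj by (rule sum.union_disjoint)
  also have "\<dots> \<le> (\<Sum>u\<in>L. a * x u ^ k) + (\<Sum>v\<in>W. b * (\<beta> ^ k * x v ^ k))"
  proof (intro add_mono sum_mono)
    fix u assume u: "u \<in> L"
    then have "y u = x u" using disj by (auto simp: y_def)
    then show "real (card {F \<in> FF. u \<in> F}) * y u ^ k \<le> a * x u ^ k"
      using a[OF u] x[of u] u by (intro mult_mono) (auto intro: order_trans[OF of_nat_0_le_iff])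
  next
    fix v assume v: "v \<in> W"
    then have "y v ^ k = \<beta> ^ k * x v ^ k" by (auto simp: y_def power_mult_distrib)
    then show "real (card {F \<in> FF. v \<in> F}) * y v ^ k \<le> b * (\<beta> ^ k * x v ^ k)"
      using b[OF v] x[of v] v \<beta> by (intro mult_mono) (auto intro: order_trans[OF of_nat_0_le_iff])
  qed
  finally show ?thesis
    by (simp add: sum_distrib_left mult_ac)
qed

lemma card_Int_add_card_Int:
  assumes "finite F" "F \<subseteq> L \<union> W" "L \<inter> W = {}"
  shows "card (F \<inter> L) + card (F \<inter> W) = card F"
proof -
  have "card ((F \<inter> L) \<union> (F \<inter> W)) = card (F \<inter> L) + card (F \<inter> W)"
    using assms by (intro card_Un_disjoint) auto
  moreover have "(F \<inter> L) \<union> (F \<inter> W) = F"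
    using assms(2) by blast
  ultimately show ?thesis by simp
qed

lemma inj_on_diff_singleton: "inj_on (\<lambda>A. A - {u}) {A. u \<in> A}"
  by (rule inj_on_inverseI[where g = "insert u"]) (simp add: insert_absorb)

section \<open>Parameters, and counts of the cliques that make up the main term\<close>

locale parameters =
  fixes k s t :: nat
  assumes k: "3 \<le> k" and s: "2 \<le> s" and st: "s \<le> t" and tk: "k + 1 \<le> t + s"
begin

text \<open>In the leading term a clique has \<open>r - 1\<close> vertices of large and \<open>m\<close> vertices of small
  weight; \<open>\<Delta>\<close> is the number of such cliques through a vertex of small weight, and \<open>\<gamma> N\<close>, for
  \<open>N\<close> vertices of small weight, is the optimal ratio of \<open>x u ^ k\<close> to \<open>x v ^ k\<close> for \<open>u\<close> of large
  and \<open>v\<close> of small weight.\<close>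

definition r :: nat where "r = min s k"

definition m :: nat where "m = k + 1 - r"

definition \<Delta> :: nat where "\<Delta> = ((s - 1) choose (r - 1)) * ((t - 1) choose (m - 1))"

definition \<gamma> :: real where "\<gamma> = real (r - 1) / (real (s - 1) * real m)"

definition e :: real where "e = real (r - 1) / real k"

definition c :: real where "c = \<Delta> * \<gamma> powr e"

text \<open>The case j \<le> 1 of the constant is \<open>r = k\<close>, \<open>m = 1\<close>; the
  case j \<ge> 2 is \<open>r = s\<close>, \<open>m\<close> = j. In the second case the
  \<open>r - 1\<close> large vertices of a clique form a set of the size \<open>s - 1\<close> that
  occurs in \<open>admissible\<close>.\<close>

lemma r_bounds: "2 \<le> r" "r \<le> s" "r \<le> k" and m_bounds: "1 \<le> m" "m \<le> t" "m + (r - 1) = k"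
  and r_eq: "2 \<le> m \<Longrightarrow> r = s"
  using k s st tk by (auto simp: r_def m_def)

lemma e_eq: "e = 1 - m / k" and e_pos: "0 < e" and e_less: "e < 1"
proof -
  have "real m + real (r - 1) = real k"
    using m_bounds(3) by (metis of_nat_add)
  then show "e = 1 - m / k"
    using k by (simp add: e_def field_simps)
  then show "e < 1"
    using k m_bounds(1) by simp
  show "0 < e"
    using k r_bounds by (simp add: e_def)
qed

lemma \<gamma>_pos: "0 < \<gamma>"
  using r_bounds s m_bounds by (simp add: \<gamma>_def)

lemma \<Delta>_pos: "0 < \<Delta>"
  using diff_le_mono[OF r_bounds(2), of 1] diff_le_mono[OF m_bounds(2), of 1]
  by (simp add: \<Delta>_def)

lemma c_pos: "0 < c"
  using \<Delta>_pos \<gamma>_pos by (simp add: c_def)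

text \<open>Two situations provide this: the large weights in a sparse graph once a bounded set is
  discarded, and the dominating set of the extremal graph. The last clause bounds, inside
  \<open>W\<close>, the common neighbours of the \<open>s\<close>-set
  \<open>insert v A\<close>.\<close>

definition admissible :: "('a \<Rightarrow> 'a \<Rightarrow> bool) \<Rightarrow> 'a set \<Rightarrow> 'a set \<Rightarrow> bool" where
  "admissible adj L W \<longleftrightarrow> finite L \<and> finite W \<and> L \<inter> W = {} \<and>
     (\<forall>v\<in>W. degree_in adj L v \<le> s - 1) \<and>
     (\<forall>v\<in>W. \<forall>A\<subseteq>L. card A = s - 1 \<longrightarrow> (\<forall>u\<in>A. adj v u) \<longrightarrow>
        card {w \<in> W. adj v w \<and> (\<forall>u\<in>A. adj w u)} \<le> t - 1)"

lemma admissible_neighbours: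
  assumes "admissible adj L W" "v \<in> W" "A \<subseteq> L" "card A = s - 1" "\<And>u. u \<in> A \<Longrightarrow> adj v u"
  shows "card {w \<in> W. adj v w \<and> (\<forall>u\<in>A. adj w u)} \<le> t - 1"
  using assms by (simp add: admissible_def)

definition main_cliques :: "('a \<Rightarrow> 'a \<Rightarrow> bool) \<Rightarrow> 'a set \<Rightarrow> 'a set \<Rightarrow> 'a set set" where
  "main_cliques adj L W = {F \<in> cliques adj (L \<union> W) k. card (F \<inter> L) = r - 1}"

text \<open>A clique through \<open>v\<close> is recovered from its part in \<open>L\<close>, which
  consists of neighbours of \<open>v\<close>, and its other \<open>m - 1\<close> vertices in
  \<open>W\<close>, which are common neighbours of \<open>v\<close> and that part. The filter
  \<open>AA\<close> serves two counts: all cliques at \<open>v\<close>, and those that also contain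
  a fixed \<open>u\<close>.\<close>

lemma card_main_cliques_at:
  assumes adm: "admissible adj L W" and v: "v \<in> W"
  shows "card {F \<in> main_cliques adj L W. v \<in> F \<and> F \<inter> L \<in> AA}
    \<le> card {A \<in> AA. A \<subseteq> {u \<in> L. adj v u} \<and> card A = r - 1} * ((t - 1) choose (m - 1))"
proof -
  let ?N = "{u \<in> L. adj v u}"
  let ?A = "{A \<in> AA. A \<subseteq> ?N \<and> card A = r - 1}"
  let ?K = "\<lambda>A. {K. K \<subseteq> {w \<in> W. adj v w \<and> (\<forall>u\<in>A. adj w u)} \<and> card K = m - 1}"
  have fin: "finite L" "finite W" and disj: "L \<inter> W = {}"
    using adm by (auto simp: admissible_def)
  have finA: "finite ?A"
    using fin by (auto intro: finite_subset[of _ "Pow L"])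
  have finK: "finite (?K A)" for A
    using fin by (auto intro: finite_subset[of _ "Pow W"])
  have card_K: "card (?K A) \<le> (t - 1) choose (m - 1)" if A: "A \<in> ?A" for A
  proof -
    have "card (?K A) = card {w \<in> W. adj v w \<and> (\<forall>u\<in>A. adj w u)} choose (m - 1)"
      using fin by (intro n_subsets) auto
    \<comment> \<open>For \<open>m = 1\<close> both binomial coefficients are 1, however many
      neighbours there are; otherwise \<open>r = s\<close>, and \<open>A\<close> has the size
      required by \<open>admissible\<close>.\<close>
    also have "\<dots> \<le> (t - 1) choose (m - 1)"
    proof (cases "m = 1")
      case False
      then have "r = s" using m_bounds r_eq by simp
      then have "card {w \<in> W. adj v w \<and> (\<forall>u\<in>A. adj w u)} \<le> t - 1"
        using v A by (intro admissible_neighbours[OF adm]) auto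
      then show ?thesis by (rule binomial_right_mono)
    qed simp
    finally show ?thesis .
  qed
  have "card {F \<in> main_cliques adj L W. v \<in> F \<and> F \<inter> L \<in> AA} \<le> card (Sigma ?A ?K)"
  proof (rule card_inj_on_le[where f = "\<lambda>F. (F \<inter> L, F \<inter> W - {v})"])
    show "inj_on (\<lambda>F. (F \<inter> L, F \<inter> W - {v})) {F \<in> main_cliques adj L W. v \<in> F \<and> F \<inter> L \<in> AA}"
    proof (rule inj_onI)
      fix F F'
      assume F: "F \<in> {F \<in> main_cliques adj L W. v \<in> F \<and> F \<inter> L \<in> AA}"
        and F': "F' \<in> {F \<in> main_cliques adj L W. v \<in> F \<and> F \<inter> L \<in> AA}"
        and eq: "(F \<inter> L, F \<inter> W - {v}) = (F' \<inter> L, F' \<inter> W - {v})"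
      have join: "F \<inter> L \<union> insert v (F \<inter> W - {v}) = F" if "F \<subseteq> L \<union> W" "v \<in> F" for F
        using that v by blast
      have "F \<subseteq> L \<union> W" "v \<in> F" "F' \<subseteq> L \<union> W" "v \<in> F'"
        using F F' by (auto simp: main_cliques_def cliques_def)
      moreover have "F \<inter> L = F' \<inter> L" "F \<inter> W - {v} = F' \<inter> W - {v}"
        using eq by simp_all
      ultimately show "F = F'" using join[of F] join[of F'] by metis
    qed
    show "(\<lambda>F. (F \<inter> L, F \<inter> W - {v})) ` {F \<in> main_cliques adj L W. v \<in> F \<and> F \<inter> L \<in> AA}
        \<subseteq> Sigma ?A ?K"
    proof (rule image_subsetI)
      fix F assume F: "F \<in> {F \<in> main_cliques adj L W. v \<in> F \<and> F \<inter> L \<in> AA}"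
      then have "F \<in> main_cliques adj L W" and vF: "v \<in> F" and AA: "F \<inter> L \<in> AA"
        by simp_all
      then have cl: "F \<subseteq> L \<union> W" "card F = k" "\<forall>a\<in>F. \<forall>b\<in>F. a \<noteq> b \<longrightarrow> adj a b"
        and FL: "card (F \<inter> L) = r - 1"
        by (simp_all add: main_cliques_def cliques_def)
      have finF: "finite F" using cl(1) fin by (auto intro: finite_subset)
      have "card (F \<inter> W) = m"
        using card_Int_add_card_Int[OF finF cl(1) disj] FL cl(2) m_bounds(3) by linarith
      then have "card (F \<inter> W - {v}) = m - 1"
        using v vF by (subst card_Diff_singleton) auto
      moreover have "F \<inter> L \<subseteq> ?N"
      proof
        fix u assume "u \<in> F \<inter> L"
        then show "u \<in> ?N" using cl(3) vF v disj by fastforce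
      qed
      moreover have "F \<inter> W - {v} \<subseteq> {w \<in> W. adj v w \<and> (\<forall>u\<in>F \<inter> L. adj w u)}"
      proof
        fix w assume w: "w \<in> F \<inter> W - {v}"
        have "adj w u" if u: "u \<in> F \<inter> L" for u
        proof -
          have "w \<noteq> u" using w u disj by auto
          then show ?thesis using cl(3) w u by simp
        qed
        moreover have "v \<noteq> w" "w \<in> W"
          using w by auto
        then have "adj v w" "w \<in> W"
          using cl(3) vF w by simp_all
        ultimately show "w \<in> {w \<in> W. adj v w \<and> (\<forall>u\<in>F \<inter> L. adj w u)}"
          by (intro CollectI conjI ballI)
      qed
      ultimately show "(F \<inter> L, F \<inter> W - {v}) \<in> Sigma ?A ?K"
        unfolding mem_Sigma_iff using FL AA by (intro conjI CollectI) assumption+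
    qed
    show "finite (Sigma ?A ?K)" using finA finK by auto
  qed
  also have "\<dots> = (\<Sum>A\<in>?A. card (?K A))"
    using finA finK by (intro card_SigmaI) auto
  also have "\<dots> \<le> (\<Sum>A\<in>?A. (t - 1) choose (m - 1))"
    by (intro sum_mono card_K)
  finally show ?thesis by simp
qed

lemma card_main_cliques_small:
  assumes "admissible adj L W" "v \<in> W"
  shows "card {F \<in> main_cliques adj L W. v \<in> F} \<le> \<Delta>"
proof -
  have fin: "finite L" using assms by (simp add: admissible_def)
  have "card {F \<in> main_cliques adj L W. v \<in> F}
      \<le> card {A. A \<subseteq> {u \<in> L. adj v u} \<and> card A = r - 1} * ((t - 1) choose (m - 1))"
    using card_main_cliques_at[OF assms, of UNIV] by simp
  also have "card {A. A \<subseteq> {u \<in> L. adj v u} \<and> card A = r - 1} = degree_in adj L v choose (r - 1)"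
    unfolding degree_in_def using fin by (intro n_subsets) auto
  also have "\<dots> \<le> (s - 1) choose (r - 1)"
    using assms by (intro binomial_right_mono) (auto simp: admissible_def)
  finally show ?thesis by (simp add: \<Delta>_def)
qed

text \<open>Prescribing \<open>u\<close> turns the choice of \<open>r - 1\<close> from
  \<open>s - 1\<close> vertices into \<open>r - 2\<close> from \<open>s - 2\<close>. This is the
  fraction \<open>(r - 1) / (s - 1) = \<gamma> * m\<close> of \<open>\<Delta>\<close>, the origin of
  \<open>\<gamma>\<close>.\<close>

lemma card_main_cliques_pair:
  assumes adm: "admissible adj L W" and v: "v \<in> W" and u: "u \<in> L"
  shows "real (card {F \<in> main_cliques adj L W. u \<in> F \<and> v \<in> F}) \<le> \<gamma> * m * \<Delta>"
proof -
  let ?N = "{u \<in> L. adj v u}"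
  have fin: "finite L" using adm by (simp add: admissible_def)
  have "{F \<in> main_cliques adj L W. v \<in> F \<and> F \<inter> L \<in> {A. u \<in> A}}
      = {F \<in> main_cliques adj L W. u \<in> F \<and> v \<in> F}"
    using u by auto
  then have "card {F \<in> main_cliques adj L W. u \<in> F \<and> v \<in> F}
      \<le> card {A \<in> {A. u \<in> A}. A \<subseteq> ?N \<and> card A = r - 1} * ((t - 1) choose (m - 1))"
    using card_main_cliques_at[OF adm v, of "{A. u \<in> A}"] by simp
  also have "card {A \<in> {A. u \<in> A}. A \<subseteq> ?N \<and> card A = r - 1} \<le> (s - 2) choose (r - 2)"
  proof (cases "u \<in> ?N")
    case True
    have "card {A \<in> {A. u \<in> A}. A \<subseteq> ?N \<and> card A = r - 1}
        \<le> card {A. A \<subseteq> ?N - {u} \<and> card A = r - 2}"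
    proof (rule card_inj_on_le[where f = "\<lambda>A. A - {u}"])
      show "inj_on (\<lambda>A. A - {u}) {A \<in> {A. u \<in> A}. A \<subseteq> ?N \<and> card A = r - 1}"
        by (rule inj_on_subset[OF inj_on_diff_singleton]) auto
      show "(\<lambda>A. A - {u}) ` {A \<in> {A. u \<in> A}. A \<subseteq> ?N \<and> card A = r - 1}
          \<subseteq> {A. A \<subseteq> ?N - {u} \<and> card A = r - 2}"
        using fin by (auto simp: card_Diff_singleton)
      show "finite {A. A \<subseteq> ?N - {u} \<and> card A = r - 2}"
        using fin by (auto intro: finite_subset[of _ "Pow L"])
    qed
    also have "\<dots> = card (?N - {u}) choose (r - 2)"
      using fin by (intro n_subsets) auto
    also have "\<dots> \<le> (s - 2) choose (r - 2)"
    proof (rule binomial_right_mono)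
      have "card ?N \<le> s - 1"
        using adm v by (auto simp: admissible_def degree_in_def)
      moreover have "card (?N - {u}) = card ?N - 1"
        using True by (rule card_Diff_singleton)
      ultimately show "card (?N - {u}) \<le> s - 2"
        by simp
    qed
    finally show ?thesis .
  next
    case False
    then have "{A \<in> {A. u \<in> A}. A \<subseteq> ?N \<and> card A = r - 1} = {}" by blast
    then show ?thesis by (metis card.empty zero_le)
  qed
  finally have "card {F \<in> main_cliques adj L W. u \<in> F \<and> v \<in> F}
      \<le> ((s - 2) choose (r - 2)) * ((t - 1) choose (m - 1))" by simp
  then have "real (card {F \<in> main_cliques adj L W. u \<in> F \<and> v \<in> F})
      \<le> real (((s - 2) choose (r - 2)) * ((t - 1) choose (m - 1)))" by (rule of_nat_mono)
  moreover have "\<gamma> * m * \<Delta> = ((s - 2) choose (r - 2)) * ((t - 1) choose (m - 1))"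
  proof -
    have "(r - 1) * ((s - 1) choose (r - 1)) = (s - 1) * ((s - 2) choose (r - 2))"
      using times_binomial_minus1_eq[of "r - 1" "s - 1", unfolded diff_diff_left one_add_one] r_bounds
      by simp
    then have "real (r - 1) * ((s - 1) choose (r - 1)) = real (s - 1) * ((s - 2) choose (r - 2))"
      by (metis of_nat_mult)
    then have "real (r - 1) / real (s - 1) * ((s - 1) choose (r - 1)) = ((s - 2) choose (r - 2))"
      using s by (simp add: field_simps)
    moreover have "\<gamma> * m = real (r - 1) / real (s - 1)"
      using m_bounds by (simp add: \<gamma>_def)
    ultimately show ?thesis
      by (simp add: \<Delta>_def mult.assoc[symmetric])
  qed
  ultimately show ?thesis
    by (simp only:)
qed

text \<open>Double counting of pairs of a clique through \<open>u\<close> and a vertex of it in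
  \<open>W\<close>: each clique has \<open>m\<close> such vertices, which cancels the factor
  \<open>m\<close> in the bound for pairs.\<close>

lemma card_main_cliques_large:
  assumes adm: "admissible adj L W" and u: "u \<in> L"
  shows "real (card {F \<in> main_cliques adj L W. u \<in> F}) \<le> card W * \<gamma> * \<Delta>"
proof -
  let ?M = "{F \<in> main_cliques adj L W. u \<in> F}"
  have fin: "finite L" "finite W" and disj: "L \<inter> W = {}"
    using adm by (auto simp: admissible_def)
  have finM: "finite ?M"
    using fin by (simp add: main_cliques_def finite_cliques)
  have cW: "card {v \<in> W. v \<in> F} = m" if "F \<in> ?M" for F
  proof -
    have F: "F \<subseteq> L \<union> W" "card F = k" "card (F \<inter> L) = r - 1"
      using that by (auto simp: main_cliques_def cliques_def)
    have finF: "finite F" using F(1) fin by (auto intro: finite_subset)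
    have "card {v \<in> W. v \<in> F} = card (F \<inter> W)"
      by (rule arg_cong[where f = card]) blast
    then show ?thesis
      using card_Int_add_card_Int[OF finF F(1) disj] F m_bounds by simp
  qed
  have "m * card ?M = (\<Sum>v\<in>W. card {F \<in> ?M. v \<in> F})"
    by (rule sum_multicount[OF fin(2) finM, symmetric]) (use cW in blast)
  then have "real (m * card ?M) = real (\<Sum>v\<in>W. card {F \<in> ?M. v \<in> F})"
    by (rule arg_cong)
  then have "m * real (card ?M) = (\<Sum>v\<in>W. real (card {F \<in> ?M. v \<in> F}))"
    by (simp only: of_nat_mult of_nat_sum)
  also have "\<dots> \<le> (\<Sum>v\<in>W. \<gamma> * m * \<Delta>)"
  proof (rule sum_mono)
    fix v assume v: "v \<in> W"
    have eq: "{F \<in> ?M. v \<in> F} = {F \<in> main_cliques adj L W. u \<in> F \<and> v \<in> F}" by blast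
    show "real (card {F \<in> ?M. v \<in> F}) \<le> \<gamma> * m * \<Delta>"
      unfolding eq by (rule card_main_cliques_pair[OF adm v u])
  qed
  finally show ?thesis
    using m_bounds by (simp add: field_simps)
qed

text \<open>For the extremal graph, equality holds for \<open>\<mu> = 1\<close> at the optimal vector; the freedom in
  \<open>\<mu>\<close> locates the mass of \<open>L\<close> in every near-optimal vector.\<close>

lemma main_term_bound:
  fixes x :: "'a \<Rightarrow> real" and n :: nat and \<mu> :: real
  assumes adm: "admissible adj L W" and n: "n > 0" "card W \<le> n"
    and x: "\<And>v. v \<in> L \<union> W \<Longrightarrow> 0 \<le> x v" and \<mu>: "\<mu> > 0"
  shows "k * (\<Sum>F\<in>main_cliques adj L W. \<Prod>v\<in>F. x v)
    \<le> c * n powr e * (\<mu> powr (e - 1) * ((\<Sum>u\<in>L. x u ^ k) + \<mu> * (\<Sum>v\<in>W. x v ^ k)))"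
    (is "_ * ?S \<le> _ * (_ * (?p + _ * ?q))")
proof -
  let ?M = "main_cliques adj L W"
  \<comment> \<open>Here \<open>\<beta> ^ k = \<mu> * n * \<gamma>\<close>. At
    \<open>\<mu> = 1\<close> the two coefficients agree: \<open>n * \<gamma> * \<Delta>\<close>
    cliques at a large vertex against \<open>\<Delta>\<close> at a small one, the latter multiplied
    by \<open>\<beta> ^ k\<close>.\<close>
  define \<beta> where "\<beta> = (\<mu> * n * \<gamma>) powr (1 / k)"
  have pos: "0 < \<mu> * n * \<gamma>" using \<mu> n \<gamma>_pos by simp
  have \<beta>: "\<beta> > 0" using pos by (simp only: \<beta>_def powr_gt_zero)
  have \<beta>k: "\<beta> ^ k = \<mu> * n * \<gamma>"
    unfolding \<beta>_def using powr_divide_power[OF pos, of k k] k pos by simp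
  have \<beta>m: "\<beta> ^ m = (\<mu> * n * \<gamma>) powr (1 - e)"
    unfolding \<beta>_def using powr_divide_power[OF pos, of k m] by (simp add: e_eq)
  have fin: "finite L" "finite W" and disj: "L \<inter> W = {}"
    using adm by (auto simp: admissible_def)
  have "\<beta> ^ m * (k * ?S) \<le> (n * \<gamma> * \<Delta>) * ?p + \<beta> ^ k * \<Delta> * ?q"
  proof (rule weighted_sum_prod_le)
    fix F assume "F \<in> ?M"
    then have F: "F \<subseteq> L \<union> W" "card F = k" "card (F \<inter> L) = r - 1"
      by (auto simp: main_cliques_def cliques_def)
    have finF: "finite F" using F(1) fin by (auto intro: finite_subset)
    have "card (F \<inter> W) = m"
      using card_Int_add_card_Int[OF finF F(1) disj] F m_bounds by simp
    then show "F \<subseteq> L \<union> W \<and> card F = k \<and> \<beta> ^ m \<le> \<beta> ^ card (F \<inter> W)"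
      using F by simp
  next
    fix u assume u: "u \<in> L"
    have "real (card W) * \<gamma> * \<Delta> \<le> n * \<gamma> * \<Delta>"
      using n \<gamma>_pos by (intro mult_right_mono) auto
    then show "real (card {F \<in> ?M. u \<in> F}) \<le> n * \<gamma> * \<Delta>"
      using card_main_cliques_large[OF adm u] by linarith
  next
    show "real (card {F \<in> ?M. v \<in> F}) \<le> real \<Delta>" if "v \<in> W" for v
      using card_main_cliques_small[OF adm that] by simp
  qed (use fin disj x \<beta> k in auto)
  also have "\<dots> = n * \<gamma> * \<Delta> * (?p + \<mu> * ?q)"
    by (simp add: \<beta>k algebra_simps)
  finally have "k * ?S \<le> n * \<gamma> * \<Delta> * (?p + \<mu> * ?q) / \<beta> ^ m"
    using \<beta> by (simp add: field_simps)
  also have "\<dots> = c * n powr e * (\<mu> powr (e - 1) * (?p + \<mu> * ?q))"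
  proof -
    have "n * \<gamma> / \<beta> ^ m = (n * \<gamma>) powr 1 / (\<mu> powr (1 - e) * (n * \<gamma>) powr (1 - e))"
      using \<mu> n \<gamma>_pos by (simp add: \<beta>m powr_mult mult.assoc)
    also have "\<dots> = \<mu> powr (e - 1) * (n * \<gamma>) powr e"
      by (simp add: powr_diff powr_minus field_simps)
    also have "\<dots> = \<mu> powr (e - 1) * (n powr e * \<gamma> powr e)"
      using \<gamma>_pos by (simp add: powr_mult)
    finally have "n * \<gamma> / \<beta> ^ m = \<mu> powr (e - 1) * (n powr e * \<gamma> powr e)" .
    then have "(n * \<gamma> / \<beta> ^ m) * (\<Delta> * (?p + \<mu> * ?q))
        = \<mu> powr (e - 1) * (n powr e * \<gamma> powr e) * (\<Delta> * (?p + \<mu> * ?q))" by simp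
    then show ?thesis by (simp add: c_def mult_ac)
  qed
  finally show ?thesis .
qed

end

subsection \<open>The upper bound for sparse graphs\<close>

lemma sum_le_sum_cover:
  fixes g :: "'a \<Rightarrow> real"
  assumes "finite B" "finite I" "\<And>i. i \<in> I \<Longrightarrow> G i \<subseteq> B" "\<And>b. b \<in> B \<Longrightarrow> \<exists>i\<in>I. b \<in> G i"
    and "\<And>b. b \<in> B \<Longrightarrow> 0 \<le> g b"
  shows "sum g B \<le> (\<Sum>i\<in>I. sum g (G i))"
proof -
  have "sum g B \<le> (\<Sum>b\<in>B. \<Sum>i\<in>{i \<in> I. b \<in> G i}. g b)"
  proof (rule sum_mono)
    fix b assume b: "b \<in> B"
    then have "0 < card {i \<in> I. b \<in> G i}"
      using assms(2,4) by (auto simp: card_gt_0_iff)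
    then have "1 * g b \<le> card {i \<in> I. b \<in> G i} * g b"
      using assms(5)[OF b] by (intro mult_right_mono) auto
    then show "g b \<le> (\<Sum>i\<in>{i \<in> I. b \<in> G i}. g b)" by simp
  qed
  also have "\<dots> = (\<Sum>i\<in>I. \<Sum>b\<in>{b \<in> B. b \<in> G i}. g b)"
    using assms(1,2) by (rule sum.swap_restrict)
  also have "\<dots> = (\<Sum>i\<in>I. sum g (G i))"
    using assms(3) by (intro sum.cong refl) auto
  finally show ?thesis .
qed

section \<open>Sparsity, and cliques with too many or too few vertices of large weight\<close>

context parameters
begin

text \<open>The interface between minors and the estimates: bounded common neighbourhoods, and
  linearly many cliques of the two sizes \<open>r\<close> and \<open>k\<close>, with one constant
  for both.\<close>

definition sparse :: "nat \<Rightarrow> ('a \<Rightarrow> 'a \<Rightarrow> bool) \<Rightarrow> 'a set \<Rightarrow> bool" where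
  "sparse C adj V \<longleftrightarrow> symp adj \<and> finite V \<and>
     (\<forall>A\<subseteq>V. card A = s \<longrightarrow> card (common_nbrs adj V A) \<le> t - 1) \<and>
     (\<forall>X\<subseteq>V. card (cliques adj X r) \<le> C * card X) \<and>
     (\<forall>X\<subseteq>V. card (cliques adj X k) \<le> C * card X)"

text \<open>An \<open>r\<close>-subset \<open>A\<close> of \<open>Z\<close> inside the clique determines the clique up to boundedly many
  choices: for \<open>r = s\<close> its other vertices are common neighbours of \<open>A\<close>, and for \<open>r = k\<close> there
  are none.\<close>

lemma card_cliques_meeting:
  assumes sp: "sparse C adj V" and Z: "Z \<subseteq> V"
  shows "card {F \<in> cliques adj V k. r \<le> card (F \<inter> Z)} \<le> C * 2 ^ t * card Z"
proof -
  let ?M = "{F \<in> cliques adj V k. r \<le> card (F \<inter> Z)}"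
  let ?E = "\<lambda>A. if r = k then {{}} else Pow (common_nbrs adj V A)"
  have fin: "finite V" "finite Z"
    using sp Z by (auto simp: sparse_def intro: finite_subset)
  have finN: "finite (common_nbrs adj V A)" for A
    using fin by (simp add: common_nbrs_def)
  have "\<exists>A. A \<subseteq> F \<inter> Z \<and> card A = r" if "F \<in> ?M" for F
  proof -
    have "r \<le> card (F \<inter> Z)" using that by simp
    then show ?thesis by (metis obtain_subset_with_card_n)
  qed
  then have "\<exists>f. \<forall>F\<in>?M. f F \<subseteq> F \<inter> Z \<and> card (f F) = r"
    by (intro bchoice ballI)
  then obtain f where f: "\<And>F. F \<in> ?M \<Longrightarrow> f F \<subseteq> F \<inter> Z" "\<And>F. F \<in> ?M \<Longrightarrow> card (f F) = r"
    by blast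
  have card_E: "card (?E A) \<le> 2 ^ t" if A: "A \<in> cliques adj Z r" for A
  proof (cases "r = k")
    case False
    then have "r = s" by (auto simp: r_def)
    then have "card A = s" "A \<subseteq> V" using A Z by (auto simp: cliques_def)
    then have "card (common_nbrs adj V A) \<le> t - 1"
      using sp by (simp add: sparse_def)
    then show ?thesis
      using False finN[of A] by (simp add: card_Pow)
  qed simp
  have "card ?M \<le> card (Sigma (cliques adj Z r) ?E)"
  proof (rule card_inj_on_le[where f = "\<lambda>F. (f F, F - f F)"])
    show "inj_on (\<lambda>F. (f F, F - f F)) ?M"
    proof (rule inj_on_inverseI[where g = "\<lambda>(A, B). A \<union> B"])
      fix F assume "F \<in> ?M"
      then have "f F \<subseteq> F" using f(1)[of F] by simp
      then show "(case (f F, F - f F) of (A, B) \<Rightarrow> A \<union> B) = F" by auto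
    qed
    show "(\<lambda>F. (f F, F - f F)) ` ?M \<subseteq> Sigma (cliques adj Z r) ?E"
    proof (rule image_subsetI)
      fix F assume F: "F \<in> ?M"
      then have cl: "F \<subseteq> V" "card F = k" "\<And>a b. a \<in> F \<Longrightarrow> b \<in> F \<Longrightarrow> a \<noteq> b \<Longrightarrow> adj a b"
        by (simp_all add: cliques_def)
      have fF: "f F \<subseteq> F" "f F \<subseteq> Z" "card (f F) = r"
        using f(1)[OF F] f(2)[OF F] by simp_all
      have finF: "finite F" using cl(1) fin by (auto intro: finite_subset)
      have "adj a b" if "a \<in> f F" "b \<in> f F" "a \<noteq> b" for a b
        using cl(3)[of a b] that fF(1) by auto
      then have "f F \<in> cliques adj Z r"
        using fF by (simp add: cliques_def)
      moreover have "F - f F \<in> ?E (f F)"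
      proof (cases "r = k")
        case True
        then have "f F = F"
          using fF(1,3) cl(2) finF by (intro card_subset_eq) auto
        then show ?thesis using True by simp
      next
        case False
        have "adj u v" if "v \<in> F - f F" "u \<in> f F" for u v
          using cl(3)[of u v] that fF by auto
        then have "F - f F \<subseteq> common_nbrs adj V (f F)"
          using cl(1) by (auto simp: common_nbrs_def)
        then show ?thesis using False by simp
      qed
      ultimately show "(f F, F - f F) \<in> Sigma (cliques adj Z r) ?E"
        by (rule SigmaI)
    qed
    show "finite (Sigma (cliques adj Z r) ?E)"
      using fin finN by (intro finite_SigmaI) (auto simp: finite_cliques)
  qed
  also have "\<dots> = (\<Sum>A\<in>cliques adj Z r. card (?E A))"
    using fin finN by (intro card_SigmaI) (auto simp: finite_cliques)
  also have "\<dots> \<le> card (cliques adj Z r) * 2 ^ t"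
    using sum_bounded_above[of "cliques adj Z r" "\<lambda>A. card (?E A)" "2 ^ t"] card_E by simp
  also have "\<dots> \<le> C * card Z * 2 ^ t"
    using sp Z by (intro mult_right_mono) (auto simp: sparse_def)
  finally show ?thesis by (simp add: mult_ac)
qed

text \<open>At least \<open>m\<close> vertices lie outside \<open>T\<close>; set \<open>m\<close> of
  them aside. The remaining \<open>r - 1\<close> cannot all lie in \<open>L\<close>, so one of them
  supplies the factor \<open>\<eta>\<close>, and the others are at most 1.\<close>

lemma prod_le_if_few_large:
  fixes x :: "'a \<Rightarrow> real"
  assumes F: "finite F" "card F = k" and T: "card (F \<inter> T) < r" and L: "card (F \<inter> L) + 1 < r"
    and x: "\<And>v. v \<in> F \<Longrightarrow> 0 \<le> x v" "\<And>v. v \<in> F \<Longrightarrow> x v \<le> 1"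
    and \<tau>: "\<And>v. v \<in> F - T \<Longrightarrow> x v \<le> \<tau>" and \<eta>: "\<And>v. v \<in> F - L \<Longrightarrow> x v \<le> \<eta>"
  shows "(\<Prod>v\<in>F. x v) \<le> \<eta> * \<tau> ^ m"
proof -
  have "card (F - T) = k - card (F \<inter> T)"
    using F by (metis card_Diff_subset_Int finite_Int)
  then have "m \<le> card (F - T)"
    using T m_bounds r_bounds by linarith
  then obtain Q where Q: "Q \<subseteq> F - T" "card Q = m" "finite Q"
    by (metis obtain_subset_with_card_n)
  define R where "R = F - Q"
  have finR: "finite R" using F by (simp add: R_def)
  have "card R = k - m"
    using Q F unfolding R_def by (subst card_Diff_subset) auto
  then have cardR: "card R = r - 1" using m_bounds by linarith
  have "\<not> R \<subseteq> F \<inter> L"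
  proof
    assume "R \<subseteq> F \<inter> L"
    then have "card R \<le> card (F \<inter> L)" using F by (intro card_mono) auto
    then show False using cardR L by linarith
  qed
  then obtain w where w: "w \<in> R" "w \<in> F - L"
    using R_def by blast
  have "(\<Prod>v\<in>F. x v) = (\<Prod>v\<in>R. x v) * (\<Prod>v\<in>Q. x v)"
    unfolding R_def using F Q by (intro prod.subset_diff) auto
  also have "(\<Prod>v\<in>R. x v) = x w * (\<Prod>v\<in>R - {w}. x v)"
    using finR w(1) by (rule prod.remove)
  also have "\<dots> * (\<Prod>v\<in>Q. x v) \<le> (\<eta> * 1) * (\<tau> ^ m)"
  proof (intro mult_mono)
    show "x w \<le> \<eta>" using \<eta> w by blast
    show "(\<Prod>v\<in>R - {w}. x v) \<le> 1"
      using x by (intro prod_le_1) (auto simp: R_def)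
    have "(\<Prod>v\<in>Q. x v) \<le> (\<Prod>v\<in>Q. \<tau>)"
      using Q x \<tau> by (intro prod_mono) blast
    then show "(\<Prod>v\<in>Q. x v) \<le> \<tau> ^ m" using Q by simp
    show "0 \<le> \<eta>" using \<eta>[OF w(2)] x(1)[of w] w(2) by auto
    then show "0 \<le> \<eta> * 1" by simp
    show "0 \<le> (\<Prod>v\<in>R - {w}. x v)" "0 \<le> (\<Prod>v\<in>Q. x v)"
      using x Q by (auto simp: R_def intro!: prod_nonneg)
  qed
  finally show ?thesis by simp
qed

text \<open>Markov's inequality.\<close>

lemma card_superlevel_le:
  fixes x :: "'a \<Rightarrow> real"
  assumes "finite V" "\<And>v. v \<in> V \<Longrightarrow> 0 \<le> x v" "(\<Sum>v\<in>V. x v ^ k) \<le> 1" "0 < \<tau>"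
  shows "card {v \<in> V. \<tau> \<le> x v ^ k} \<le> 1 / \<tau>"
proof -
  have "card {v \<in> V. \<tau> \<le> x v ^ k} * \<tau> \<le> (\<Sum>v\<in>{v \<in> V. \<tau> \<le> x v ^ k}. x v ^ k)"
    by (rule sum_bounded_below) simp
  also have "\<dots> \<le> (\<Sum>v\<in>V. x v ^ k)"
    using assms by (intro sum_mono2) auto
  finally show ?thesis
    using assms by (simp add: field_simps)
qed

text \<open>With q = 2 powr e, the geometric sum up to \<open>N\<close> is at most q^(N+1) / (q -
  1), and 2^N \<le> 2n bounds the numerator by q * q * n powr e.\<close>

definition dyadic_constant :: real where
  "dyadic_constant = 2 powr e * 2 powr e / (2 powr e - 1)"

lemma sum_dyadic_le:
  assumes "2 ^ N \<le> 2 * real n" "n > 0"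
  shows "(\<Sum>i\<le>N. (2 powr e) ^ i) \<le> dyadic_constant * n powr e"
proof -
  have q: "2 powr e > 1" using e_pos by simp
  have "(\<Sum>i\<le>N. (2 powr e) ^ i) = ((2 powr e) ^ Suc N - 1) / (2 powr e - 1)"
    using geometric_sum[of "2 powr e" "Suc N"] q by (simp only: lessThan_Suc_atMost)
  also have "\<dots> \<le> (2 powr e) ^ Suc N / (2 powr e - 1)"
    using q by (intro divide_right_mono) auto
  also have "(2 powr e) ^ Suc N = 2 powr e * (2 ^ N) powr e"
    by (simp add: powr_powr mult.commute flip: powr_realpow)
  also have "\<dots> \<le> 2 powr e * (2 * real n) powr e"
    using assms e_pos by (intro mult_left_mono powr_mono2) auto
  also have "\<dots> = 2 powr e * 2 powr e * n powr e"
    by (simp add: powr_mult)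
  finally show ?thesis
    using q by (simp add: dyadic_constant_def divide_right_mono)
qed

text \<open>The cliques are grouped by the dyadic level at which their \<open>r\<close>-th largest weight lies.\<close>

lemma few_large_bound:
  fixes x :: "'a \<Rightarrow> real"
  assumes sp: "sparse C adj V" and n: "n > 0" "card V \<le> n"
    and x: "\<And>v. v \<in> V \<Longrightarrow> 0 \<le> x v" "(\<Sum>v\<in>V. x v ^ k) \<le> 1"
    and \<eta>: "0 \<le> \<eta>" "\<And>v. v \<in> V - L \<Longrightarrow> x v \<le> \<eta>"
  shows "(\<Sum>F\<in>{F \<in> cliques adj V k. card (F \<inter> L) + 1 < r}. \<Prod>v\<in>F. x v)
    \<le> \<eta> * (2 * C * 2 ^ t * dyadic_constant) * n powr e"
proof -
  let ?B = "{F \<in> cliques adj V k. card (F \<inter> L) + 1 < r}"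
  define T where "T i = {v \<in> V. (1 / 2) ^ i \<le> x v ^ k}" for i :: nat
  have fin: "finite V" using sp by (simp add: sparse_def)
  have finB: "finite ?B" using fin by (simp add: finite_cliques)
  have card_T: "card (T i) \<le> (2::nat) ^ i" for i
  proof -
    have "real (card (T i)) \<le> 1 / (1 / 2) ^ i"
      unfolding T_def using fin x by (intro card_superlevel_le) auto
    also have "\<dots> = real (2 ^ i)" by (simp add: power_divide)
    finally show ?thesis by (simp only: of_nat_le_iff)
  qed
  have x1: "x v \<le> 1" if v: "v \<in> V" for v
  proof -
    have "x v ^ k \<le> (\<Sum>v\<in>V. x v ^ k)"
      using x fin v by (intro member_le_sum) auto
    then have "x v ^ k \<le> 1" using x(2) by linarith
    then show ?thesis using x(1)[OF v] k by (simp add: power_le_one_iff)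
  qed
  \<comment> \<open>At level \<open>N\<close> the threshold has dropped to about 1/n, and the linear
    bound on the number of all cliques is as good as the bound by levels.\<close>
  have "\<exists>N. n \<le> 2 ^ N \<and> 2 ^ N \<le> 2 * n"
  proof (cases "n = 1")
    case False
    then have "\<exists>N. 2 ^ N < n \<and> n \<le> 2 ^ (N + 1)"
      using n by (intro ex_power_ivl2) auto
    then show ?thesis by (metis Suc_eq_plus1 less_imp_le mult_le_mono2 power_Suc)
  qed (auto intro: exI[of _ 0])
  then obtain N where N: "n \<le> 2 ^ N" "2 ^ N \<le> 2 * n" by blast
  \<comment> \<open>The upper bound on \<open>F \<inter> T i\<close> controls the product, the lower
    bound on \<open>F \<inter> T (Suc i)\<close> the number of cliques. The last level carries no
    lower bound and is counted by the total number of cliques.\<close>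
  define G where "G i = {F \<in> ?B. card (F \<inter> T i) < r \<and> (i < N \<longrightarrow> r \<le> card (F \<inter> T (Suc i)))}" for i
  have card_G: "card (G i) \<le> C * 2 ^ t * 2 ^ Suc i" if i: "i \<le> N" for i
  proof (cases "i < N")
    case True
    have "card (G i) \<le> card {F \<in> cliques adj V k. r \<le> card (F \<inter> T (Suc i))}"
      using True fin by (intro card_mono) (auto simp: G_def finite_cliques)
    also have "\<dots> \<le> C * 2 ^ t * card (T (Suc i))"
      by (rule card_cliques_meeting[OF sp]) (auto simp: T_def)
    also have "\<dots> \<le> C * 2 ^ t * 2 ^ Suc i"
      by (rule mult_left_mono[OF card_T]) simp
    finally show ?thesis .
  next
    case False
    then have "i = N" using i by simp
    have "card (G i) \<le> card (cliques adj V k)"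
      using fin by (intro card_mono) (auto simp: G_def finite_cliques)
    also have "\<dots> \<le> C * card V" using sp by (simp add: sparse_def)
    also have "\<dots> \<le> C * 2 ^ N" using n N by (intro mult_left_mono) auto
    also have "\<dots> \<le> C * 2 ^ t * 2 ^ Suc N" by simp
    finally show ?thesis by (simp add: \<open>i = N\<close>)
  qed
  have prod_G: "(\<Prod>v\<in>F. x v) \<le> \<eta> * ((1 / 2) powr (i / k)) ^ m" if F: "F \<in> G i" for F i
  proof (rule prod_le_if_few_large)
    have F': "F \<subseteq> V" "card F = k" using F by (auto simp: G_def cliques_def)
    show "finite F" using F' fin by (auto intro: finite_subset)
    show "card F = k" by fact
    show "card (F \<inter> T i) < r" "card (F \<inter> L) + 1 < r" using F by (auto simp: G_def)
    show "0 \<le> x v" "x v \<le> 1" if "v \<in> F" for v using x x1 F' that by blast+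
    show "x v \<le> \<eta>" if "v \<in> F - L" for v using \<eta> F' that by blast
    show "x v \<le> (1 / 2) powr (i / k)" if v: "v \<in> F - T i" for v
    proof (rule power_le_imp_le_base)
      have "x v ^ k < (1 / 2) ^ i" using v F' by (auto simp: T_def)
      also have "(1 / 2 :: real) ^ i = ((1 / 2) powr (i / k)) ^ Suc (k - 1)"
        using k by (simp add: powr_powr flip: powr_realpow)
      finally show "x v ^ Suc (k - 1) \<le> ((1 / 2) powr (i / k)) ^ Suc (k - 1)"
        using k by simp
    qed simp
  qed
  have "\<exists>i\<in>{..N}. F \<in> G i" if F: "F \<in> ?B" for F
  proof -
    have finF: "finite F" using F fin by (auto simp: cliques_def intro: finite_subset)
    \<comment> \<open>At threshold 1 at most one vertex qualifies and \<open>r \<ge> 2\<close>, so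
      there is a last level with fewer than \<open>r\<close> vertices above the threshold.\<close>
    have "card (F \<inter> T 0) \<le> card (T 0)"
      using fin by (intro card_mono) (auto simp: T_def)
    then have "card (F \<inter> T 0) < r" using card_T[of 0] r_bounds by simp
    then have "\<exists>i. (card (F \<inter> T i) < r \<and> i \<le> N) \<and> (\<forall>i'. card (F \<inter> T i') < r \<and> i' \<le> N \<longrightarrow> i' \<le> i)"
      by (intro Nat.ex_has_greatest_nat[where k = 0 and b = N]) auto
    then obtain i where i: "card (F \<inter> T i) < r" "i \<le> N"
      "\<And>i'. card (F \<inter> T i') < r \<Longrightarrow> i' \<le> N \<Longrightarrow> i' \<le> i" by blast
    have "r \<le> card (F \<inter> T (Suc i))" if "i < N"
      using i(3)[of "Suc i"] that by linarith
    then have "F \<in> G i"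
      using F i(1) unfolding G_def by blast
    then show ?thesis using i(2) by blast
  qed
  then have "(\<Sum>F\<in>?B. \<Prod>v\<in>F. x v) \<le> (\<Sum>i\<le>N. \<Sum>F\<in>G i. \<Prod>v\<in>F. x v)"
    using finB x(1)
    by (intro sum_le_sum_cover) (auto simp: G_def cliques_def intro!: prod_nonneg)
  also have "\<dots> \<le> (\<Sum>i\<le>N. (2 * C * 2 ^ t * \<eta>) * (2 powr e) ^ i)"
  proof (rule sum_mono)
    fix i assume i: "i \<in> {..N}"
    have "(\<Sum>F\<in>G i. \<Prod>v\<in>F. x v) \<le> card (G i) * (\<eta> * ((1 / 2) powr (i / k)) ^ m)"
      by (rule sum_bounded_above) (rule prod_G)
    also have "\<dots> \<le> real (C * 2 ^ t * 2 ^ Suc i) * (\<eta> * ((1 / 2) powr (i / k)) ^ m)"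
      using card_G[of i] i \<eta> by (intro mult_right_mono of_nat_mono) auto
    also have "\<dots> = (2 * C * 2 ^ t * \<eta>) * (2 ^ i * ((1 / 2) powr (i / k)) ^ m)"
      by simp
    \<comment> \<open>About 2^i cliques of size about 2^(-i m / k): the contribution of a level
      grows like 2^(i e), so the last levels dominate and give \<open>n powr e\<close>.\<close>
    also have "2 ^ i * ((1 / 2) powr (i / k)) ^ m = 2 powr (i * (1 - m / k))"
      by (simp add: powr_powr powr_diff powr_divide algebra_simps flip: powr_realpow)
    also have "\<dots> = (2 powr e) ^ i"
      by (simp add: e_eq powr_powr mult.commute flip: powr_realpow)
    finally show "(\<Sum>F\<in>G i. \<Prod>v\<in>F. x v) \<le> (2 * C * 2 ^ t * \<eta>) * (2 powr e) ^ i" .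
  qed
  also have "\<dots> = (2 * C * 2 ^ t * \<eta>) * (\<Sum>i\<le>N. (2 powr e) ^ i)"
    by (simp add: sum_distrib_left)
  also have "\<dots> \<le> (2 * C * 2 ^ t * \<eta>) * (dyadic_constant * n powr e)"
  proof (intro mult_left_mono sum_dyadic_le)
    show "2 ^ N \<le> 2 * real n" using N(2) by (metis of_nat_le_iff of_nat_mult of_nat_numeral of_nat_power)
  qed (use n \<eta> in auto)
  finally show ?thesis by (simp add: mult_ac)
qed

section \<open>Splitting the clique sum by the vertices of large weight\<close>

lemma sparse_common_nbrs:
  assumes "sparse C adj V" "A \<subseteq> V" "card A = s"
  shows "card (common_nbrs adj V A) \<le> t - 1"
  using assms by (simp add: sparse_def)

text \<open>Each such vertex is a common neighbour of some \<open>s\<close>-subset of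
  \<open>L\<close>. There are at most \<open>2 ^ l\<close> of these subsets, each with fewer than
  \<open>t\<close> common neighbours.\<close>

lemma card_many_neighbours_le:
  assumes sp: "sparse C adj V" and L: "L \<subseteq> V" "card L \<le> l"
  shows "card {v \<in> V. s \<le> degree_in adj L v} \<le> 2 ^ l * t"
proof -
  have fin: "finite V" "finite L" and sym: "symp adj"
    using sp L by (auto simp: sparse_def intro: finite_subset)
  let ?A = "{A. A \<subseteq> L \<and> card A = s}"
  have finA: "finite ?A" using fin by (auto intro: finite_subset[of _ "Pow L"])
  have "{v \<in> V. s \<le> degree_in adj L v} \<subseteq> (\<Union>A\<in>?A. common_nbrs adj V A)"
  proof
    fix v assume v: "v \<in> {v \<in> V. s \<le> degree_in adj L v}"
    then obtain A where A: "A \<subseteq> {u \<in> L. adj v u}" "card A = s"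
      unfolding degree_in_def mem_Collect_eq by (metis obtain_subset_with_card_n)
    have A': "u \<in> L" "adj u v" if "u \<in> A" for u
      using subsetD[OF A(1) that] sym by (auto dest: sympD)
    then have "v \<in> common_nbrs adj V A" using v by (simp add: common_nbrs_def)
    moreover have "A \<in> ?A" using A' A(2) by (simp add: subsetI)
    ultimately show "v \<in> (\<Union>A\<in>?A. common_nbrs adj V A)" by (rule UN_I[rotated])
  qed
  then have "card {v \<in> V. s \<le> degree_in adj L v} \<le> card (\<Union>A\<in>?A. common_nbrs adj V A)"
    using fin finA by (intro card_mono) (auto simp: common_nbrs_def)
  also have "\<dots> \<le> (\<Sum>A\<in>?A. card (common_nbrs adj V A))"
    using finA by (rule card_UN_le)
  also have "\<dots> \<le> (\<Sum>A\<in>?A. t)"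
  proof (rule sum_mono)
    fix A assume "A \<in> ?A"
    then have "A \<subseteq> V" "card A = s" using L by auto
    then show "card (common_nbrs adj V A) \<le> t"
      using sparse_common_nbrs[OF sp, of A] by linarith
  qed
  also have "\<dots> = card ?A * t" by simp
  also have "card ?A \<le> card (Pow L)"
    using fin by (intro card_mono) auto
  also have "card (Pow L) \<le> 2 ^ l"
    using fin L by (simp add: card_Pow)
  finally show ?thesis by simp
qed

text \<open>As \<open>W\<close> avoids \<open>L\<close>, a vertex of \<open>W\<close> together with
  \<open>s - 1\<close> vertices of \<open>L\<close> is an \<open>s\<close>-set, so the bound on
  common neighbours applies to it.\<close>

lemma admissible_of_sparse:
  assumes sp: "sparse C adj V" and L: "L \<subseteq> V" and W: "W \<subseteq> V" "L \<inter> W = {}"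
    and deg: "\<And>v. v \<in> W \<Longrightarrow> degree_in adj L v < s"
  shows "admissible adj L W"
  unfolding admissible_def
proof (intro conjI ballI allI impI)
  have fin: "finite V" and sym: "symp adj" using sp by (auto simp: sparse_def)
  show finL: "finite L" and "finite W" using fin L W by (auto intro: finite_subset)
  show "L \<inter> W = {}" by fact
  show "degree_in adj L v \<le> s - 1" if "v \<in> W" for v using deg[OF that] by simp
  fix v A assume v: "v \<in> W" and A: "A \<subseteq> L" "card A = s - 1"
  have "{w \<in> W. adj v w \<and> (\<forall>u\<in>A. adj w u)} \<subseteq> common_nbrs adj V (insert v A)"
    using W sym by (auto simp: common_nbrs_def dest: sympD)
  then have "card {w \<in> W. adj v w \<and> (\<forall>u\<in>A. adj w u)} \<le> card (common_nbrs adj V (insert v A))"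
    using fin by (intro card_mono) (auto simp: common_nbrs_def)
  also have "\<dots> \<le> t - 1"
  proof (rule sparse_common_nbrs[OF sp])
    show "insert v A \<subseteq> V" using v A W L by blast
    have "v \<notin> A" "finite A" using v A W finL by (auto intro: finite_subset)
    then show "card (insert v A) = s" using A s by simp
  qed
  finally show "card {w \<in> W. adj v w \<and> (\<forall>u\<in>A. adj w u)} \<le> t - 1" .
qed

text \<open>If the last two alternatives fail, \<open>F\<close> has exactly \<open>r - 1\<close>
  vertices in \<open>L\<close> and as many in \<open>Z\<close>. The two intersections then coincide,
  so \<open>F\<close> avoids \<open>Z - L\<close>.\<close>

lemma cliques_cases:
  assumes sp: "sparse C adj V" and F: "F \<in> cliques adj V k" and L: "L \<subseteq> Z" "Z \<subseteq> V"
  shows "F \<in> main_cliques adj L (V - Z) \<or> card (F \<inter> L) + 1 < r \<or> r \<le> card (F \<inter> Z)"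
proof -
  have fin: "finite V" using sp by (simp add: sparse_def)
  have cl: "F \<subseteq> V" using F by (simp add: cliques_def)
  then have finF: "finite F" using fin by (rule finite_subset)
  have "F \<in> main_cliques adj L (V - Z)" if *: "r \<le> card (F \<inter> L) + 1" "card (F \<inter> Z) < r"
  proof -
    have sub: "F \<inter> L \<subseteq> F \<inter> Z" using L by blast
    then have "card (F \<inter> L) \<le> card (F \<inter> Z)" using finF by (intro card_mono) auto
    then have eq: "card (F \<inter> L) = card (F \<inter> Z)" "card (F \<inter> L) = r - 1" using * by linarith+
    then have "F \<inter> L = F \<inter> Z" using sub finF by (intro card_subset_eq) auto
    then have "F \<subseteq> L \<union> (V - Z)" using cl by blast
    then show ?thesis using F eq by (simp add: main_cliques_def cliques_def)
  qed
  then show ?thesis by linarith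
qed

text \<open>\<open>Z\<close> enlarges \<open>L\<close> by the boundedly many vertices with
  \<open>s\<close> or more neighbours in \<open>L\<close>, which makes the complement admissible.
  The constant \<open>c\<close> comes from the main cliques, the multiple of \<open>\<eta>\<close>
  from the cliques with few vertices in \<open>L\<close>. The last term counts the cliques with
  \<open>r\<close> or more vertices in \<open>Z\<close>, whose products are at most 1; it does not
  grow with \<open>n\<close>.\<close>

lemma clique_sum_bound:
  fixes x :: "'a \<Rightarrow> real" and l :: nat
  assumes sp: "sparse C adj V" and n: "n > 0" "card V \<le> n"
    and x: "\<And>v. v \<in> V \<Longrightarrow> 0 \<le> x v" "(\<Sum>v\<in>V. x v ^ k) \<le> 1"
    and \<eta>: "0 < \<eta>" "1 / \<eta> ^ k \<le> l"
  shows "k * (\<Sum>F\<in>cliques adj V k. \<Prod>v\<in>F. x v)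
    \<le> (c + k * (\<eta> * (2 * C * 2 ^ t * dyadic_constant))) * n powr e + real k * real (C * 2 ^ t * (l + 2 ^ l * t))"
proof -
  have fin: "finite V" using sp by (simp add: sparse_def)
  define L where "L = {v \<in> V. \<eta> ^ k \<le> x v ^ k}"
  define Z where "Z = L \<union> {v \<in> V. s \<le> degree_in adj L v}"
  have LV: "L \<subseteq> V" "Z \<subseteq> V" "L \<subseteq> Z" by (auto simp: L_def Z_def)
  have "real (card L) \<le> 1 / \<eta> ^ k"
    unfolding L_def using fin x \<eta> by (intro card_superlevel_le) auto
  then have card_L: "card L \<le> l" using \<eta> by linarith
  have card_Z: "card Z \<le> l + 2 ^ l * t"
    using card_Un_le[of L "{v \<in> V. s \<le> degree_in adj L v}"] card_L
      card_many_neighbours_le[OF sp LV(1) card_L] unfolding Z_def by linarith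
  have x1: "x v \<le> 1" if v: "v \<in> V" for v
  proof -
    have "x v ^ k \<le> (\<Sum>v\<in>V. x v ^ k)"
      using x fin v by (intro member_le_sum) auto
    then have "x v ^ k \<le> 1" using x(2) by linarith
    then show ?thesis using x(1)[OF v] k by (simp add: power_le_one_iff)
  qed
  let ?M = "main_cliques adj L (V - Z)" and ?S = "{F \<in> cliques adj V k. card (F \<inter> L) + 1 < r}"
    and ?R = "{F \<in> cliques adj V k. r \<le> card (F \<inter> Z)}"
  define f where "f F = (\<Prod>v\<in>F. x v)" for F
  have f0: "0 \<le> f F" if "F \<in> cliques adj V k" for F
    using that x by (auto simp: f_def cliques_def intro!: prod_nonneg)
  have MV: "?M \<subseteq> cliques adj V k"
    using LV by (auto simp: main_cliques_def cliques_def)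
  have finV: "finite (cliques adj V k)" using fin by (rule finite_cliques)
  define G where "G i = (if i = 0 then ?M else if i = 1 then ?S else ?R)" for i :: nat
  have "sum f (cliques adj V k) \<le> (\<Sum>i\<in>{0, 1, 2}. sum f (G i))"
  proof (rule sum_le_sum_cover[OF finV _ _ _ f0])
    fix F assume F: "F \<in> cliques adj V k"
    consider "F \<in> ?M" | "F \<in> ?S" | "F \<in> ?R"
      using cliques_cases[OF sp F LV(3,2)] F by blast
    then show "\<exists>i\<in>{0, 1, 2}. F \<in> G i"
      by cases (auto simp: G_def)
  qed (use MV in \<open>auto simp: G_def\<close>)
  then have "sum f (cliques adj V k) \<le> sum f ?M + sum f ?S + sum f ?R"
    by (simp add: G_def)
  then have "k * sum f (cliques adj V k) \<le> k * (sum f ?M + sum f ?S + sum f ?R)"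
    by (rule mult_left_mono) simp
  moreover have "k * sum f ?M \<le> c * n powr e"
  proof -
    have "admissible adj L (V - Z)"
      using LV by (intro admissible_of_sparse[OF sp]) (auto simp: Z_def)
    moreover have "card (V - Z) \<le> n"
      using n fin card_mono[of V "V - Z"] by simp
    ultimately have "k * sum f ?M
        \<le> c * n powr e * (1 powr (e - 1) * ((\<Sum>u\<in>L. x u ^ k) + 1 * (\<Sum>v\<in>V - Z. x v ^ k)))"
      unfolding f_def using LV x n by (intro main_term_bound) auto
    also have "\<dots> \<le> c * n powr e * 1"
    proof (rule mult_left_mono)
      have "(\<Sum>u\<in>L. x u ^ k) + (\<Sum>v\<in>V - Z. x v ^ k) = (\<Sum>v\<in>L \<union> (V - Z). x v ^ k)"
        using fin LV by (intro sum.union_disjoint[symmetric]) (auto intro: finite_subset)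
      also have "\<dots> \<le> (\<Sum>v\<in>V. x v ^ k)"
        using fin LV x by (intro sum_mono2) auto
      finally show "1 powr (e - 1) * ((\<Sum>u\<in>L. x u ^ k) + 1 * (\<Sum>v\<in>V - Z. x v ^ k)) \<le> 1"
        using x(2) by simp
    qed (use c_pos in simp)
    finally show ?thesis by simp
  qed
  moreover have "k * sum f ?S \<le> k * (\<eta> * (2 * C * 2 ^ t * dyadic_constant) * n powr e)"
  proof (rule mult_left_mono)
    have "x v \<le> \<eta>" if v: "v \<in> V - L" for v
    proof -
      have "x v ^ k < \<eta> ^ k" using v by (simp add: L_def not_le)
      then show ?thesis
        using \<eta>(1) by (meson less_imp_le power_less_imp_less_base)
    qed
    then show "sum f ?S \<le> \<eta> * (2 * C * 2 ^ t * dyadic_constant) * n powr e"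
      unfolding f_def using few_large_bound[OF sp n x, where \<eta> = \<eta> and L = L] \<eta>(1) by simp
  qed simp
  moreover have "k * sum f ?R \<le> real k * real (C * 2 ^ t * (l + 2 ^ l * t))"
  proof (rule mult_left_mono)
    have "sum f ?R \<le> real (card ?R) * 1"
    proof (rule sum_bounded_above)
      fix F assume "F \<in> ?R"
      then have "F \<subseteq> V" by (simp add: cliques_def)
      then show "f F \<le> 1" unfolding f_def using x x1 by (intro prod_le_1) auto
    qed
    also have "real (card ?R) * 1 \<le> real (C * 2 ^ t * (l + 2 ^ l * t))"
      unfolding mult_1_right of_nat_le_iff
      using card_cliques_meeting[OF sp LV(2)] mult_left_mono[OF card_Z, of "C * 2 ^ t"] by linarith
    finally show "sum f ?R \<le> real (C * 2 ^ t * (l + 2 ^ l * t))" .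
  qed simp
  ultimately show ?thesis
    unfolding f_def distrib_left by (simp add: algebra_simps)
qed

text \<open>\<open>N\<close> is chosen before the graph and the vector, since the bound is later
  applied to a whole class at once. First \<open>\<eta>\<close> is fixed so that its term costs at
  most half of \<open>\<delta>\<close>; the constant \<open>K\<close>, which depends on
  \<open>\<eta>\<close>, is then absorbed by the growth of \<open>n powr e\<close>.\<close>

lemma sparse_upper_bound:
  assumes \<delta>: "0 < \<delta>"
  shows "\<exists>N>0. \<forall>n\<ge>N. \<forall>adj (V :: 'a set) (x :: 'a \<Rightarrow> real). sparse C adj V \<longrightarrow> card V \<le> n \<longrightarrow>
    (\<forall>v\<in>V. 0 \<le> x v) \<longrightarrow> (\<Sum>v\<in>V. x v ^ k) \<le> 1 \<longrightarrow>
    k * (\<Sum>F\<in>cliques adj V k. \<Prod>v\<in>F. x v) \<le> (c + \<delta>) * real n powr e"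
proof -
  define M where "M = k * (2 * C * 2 ^ t * dyadic_constant)"
  have "dyadic_constant \<ge> 0" using e_pos ge_one_powr_ge_zero[of 2 e] by (simp add: dyadic_constant_def)
  then have M: "M \<ge> 0" by (simp add: M_def)
  define \<eta> where "\<eta> = \<delta> / (2 * (M + 1))"
  have \<eta>: "\<eta> > 0" using M \<delta> by (simp add: \<eta>_def)
  have "\<eta> * M \<le> \<delta> / 2" using M \<delta> by (simp add: \<eta>_def field_simps)
  define l where "l = nat \<lceil>1 / \<eta> ^ k\<rceil>"
  have l: "1 / \<eta> ^ k \<le> l" unfolding l_def by (rule real_nat_ceiling_ge)
  define K where "K = real k * real (C * 2 ^ t * (l + 2 ^ l * t))"
  have "(\<lambda>n. K * real n powr - e) \<longlonglongrightarrow> K * 0"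
    using e_pos by (intro tendsto_intros tendsto_neg_powr filterlim_real_sequentially) auto
  then have "eventually (\<lambda>n. K * real n powr - e < \<delta> / 2) sequentially"
    using \<delta> by (intro order_tendstoD(2)) auto
  then obtain N where N: "\<And>n. n \<ge> N \<Longrightarrow> K * real n powr - e < \<delta> / 2"
    by (auto simp: eventually_at_top_linorder)
  show ?thesis
  proof (intro exI[of _ "Suc N"] conjI allI impI)
    fix n adj and V :: "'a set" and x :: "'a \<Rightarrow> real"
    assume n: "Suc N \<le> n" and sp: "sparse C adj V" and V: "card V \<le> n"
      and x: "\<forall>v\<in>V. 0 \<le> x v" "(\<Sum>v\<in>V. x v ^ k) \<le> 1"
    have "k * (\<Sum>F\<in>cliques adj V k. \<Prod>v\<in>F. x v) \<le> (c + \<eta> * M) * n powr e + K"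
      using clique_sum_bound[OF sp _ V _ x(2) \<eta> l] n x(1) by (simp add: M_def K_def mult_ac)
    also have "\<dots> \<le> (c + \<delta> / 2) * n powr e + \<delta> / 2 * n powr e"
    proof (intro add_mono mult_right_mono)
      show "K \<le> \<delta> / 2 * n powr e" using N[of n] n by (simp add: powr_minus field_simps)
    qed (use \<open>\<eta> * M \<le> \<delta> / 2\<close> in auto)
    finally show "k * (\<Sum>F\<in>cliques adj V k. \<Prod>v\<in>F. x v) \<le> (c + \<delta>) * real n powr e"
      by (simp add: algebra_simps)
  qed simp
qed

end

subsection \<open>Hypergraphs whose shadow has no complete bipartite minor\<close>

lemma connected_subset_iff:
  "connected_subset G B \<longleftrightarrow> connected_in (\<lambda>u v. {u, v} \<in> edges G) B \<and> B \<subseteq> verts G"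
  by (auto simp: connected_subset_def connected_in_def)

lemma has_complete_bipartite_minorI:
  assumes P: "\<And>i. i < s \<Longrightarrow> connected_subset G (P i)" and Q: "\<And>j. j < t \<Longrightarrow> connected_subset G (Q j)"
    and PP: "\<And>i i'. i < s \<Longrightarrow> i' < s \<Longrightarrow> i \<noteq> i' \<Longrightarrow> P i \<inter> P i' = {}"
    and QQ: "\<And>j j'. j < t \<Longrightarrow> j' < t \<Longrightarrow> j \<noteq> j' \<Longrightarrow> Q j \<inter> Q j' = {}"
    and PQ: "\<And>i j. i < s \<Longrightarrow> j < t \<Longrightarrow> P i \<inter> Q j = {}"
    and edge: "\<And>i j. i < s \<Longrightarrow> j < t \<Longrightarrow> \<exists>u\<in>P i. \<exists>v\<in>Q j. {u, v} \<in> edges G"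
  shows "has_minor G (complete_bipartite s t)"
  unfolding has_minor_def
proof (intro exI[of _ "case_sum P Q"] conjI ballI impI)
  fix p assume "p \<in> verts (complete_bipartite s t)"
  then show "connected_subset G (case_sum P Q p)"
    using P Q by (auto simp: complete_bipartite_def)
next
  show "disjoint_family_on (case_sum P Q) (verts (complete_bipartite s t))"
    unfolding disjoint_family_on_def
  proof (intro ballI impI)
    fix p q :: "nat + nat"
    assume "p \<in> verts (complete_bipartite s t)" "q \<in> verts (complete_bipartite s t)" "p \<noteq> q"
    then show "case_sum P Q p \<inter> case_sum P Q q = {}"
      using PP QQ PQ Int_commute[of "Q _" "P _"]
      by (cases p; cases q) (simp_all add: complete_bipartite_def Plus_def image_iff)
  qed
next
  fix p q assume "{p, q} \<in> edges (complete_bipartite s t)"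
  then obtain i j where ij: "i < s" "j < t" "{p, q} = {Inl i, Inr j}"
    by (auto simp: complete_bipartite_def)
  obtain u v where uv: "u \<in> P i" "v \<in> Q j" "{u, v} \<in> edges G"
    using edge[OF ij(1,2)] by blast
  then have vu: "{v, u} \<in> edges G" by (simp add: insert_commute)
  have "p = Inl i \<and> q = Inr j \<or> p = Inr j \<and> q = Inl i"
    using ij(3) by (auto simp: doubleton_eq_iff)
  then show "\<exists>u\<in>case_sum P Q p. \<exists>v\<in>case_sum P Q q. {u, v} \<in> edges G"
    using uv vu by (elim disjE conjE; simp; blast)
qed

text \<open>In a model of the complete graph on \<open>s + t\<close> vertices, the first
  \<open>s\<close> branch sets form one side and the last \<open>t\<close> the other.\<close>

lemma complete_bipartite_minor_of_dense:
  assumes adj: "symp (\<lambda>u v. {u, v} \<in> edges G)" "irreflp (\<lambda>u v. {u, v} \<in> edges G)"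
    and Y: "finite Y" "Y \<noteq> {}" "Y \<subseteq> verts G"
    and dense: "2 ^ (s + t + 1) * card Y \<le> degree_sum (\<lambda>u v. {u, v} \<in> edges G) Y"
  shows "has_minor G (complete_bipartite s t)"
proof -
  obtain B :: "nat \<Rightarrow> 'a set" where B: "\<And>i. i < s + t \<Longrightarrow> connected_in (\<lambda>u v. {u, v} \<in> edges G) (B i)"
      "\<And>i. i < s + t \<Longrightarrow> B i \<subseteq> Y"
      "\<And>i j. i < s + t \<Longrightarrow> j < s + t \<Longrightarrow> i \<noteq> j \<Longrightarrow> B i \<inter> B j = {}"
      "\<And>i j. i < s + t \<Longrightarrow> j < s + t \<Longrightarrow> i \<noteq> j \<Longrightarrow> \<exists>u\<in>B i. \<exists>v\<in>B j. {u, v} \<in> edges G"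
    using clique_model_of_dense[OF adj Y(1,2) dense] by blast
  have conn: "connected_subset G (B i)" if "i < s + t" for i
    using B(1,2)[OF that] Y(3) by (auto simp: connected_subset_iff)
  show ?thesis
    by (rule has_complete_bipartite_minorI[where P = B and Q = "\<lambda>j. B (s + j)"])
      (use conn B(3,4) in simp_all)
qed

text \<open>The minor is a subgraph here, with one-vertex branch sets; irreflexivity keeps the two
  sides disjoint.\<close>

lemma complete_bipartite_minor_of_common_nbrs:
  assumes irrefl: "irreflp (\<lambda>u v. {u, v} \<in> edges G)" and fin: "finite (verts G)"
    and A: "A \<subseteq> verts G" "card A = s"
    and large: "t \<le> card (common_nbrs (\<lambda>u v. {u, v} \<in> edges G) (verts G) A)"
  shows "has_minor G (complete_bipartite s t)"
proof -
  let ?N = "common_nbrs (\<lambda>u v. {u, v} \<in> edges G) (verts G) A"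
  obtain T where T: "T \<subseteq> ?N" "card T = t" "finite T"
    using large by (rule obtain_subset_with_card_n)
  have "finite A" using A fin by (auto intro: finite_subset)
  then obtain f where f: "bij_betw f {..<s} A"
    using ex_bij_betw_nat_finite[of A] A by (auto simp: atLeast0LessThan)
  obtain g where g: "bij_betw g {..<t} T"
    using ex_bij_betw_nat_finite[of T] T by (auto simp: atLeast0LessThan)
  have edge: "{a, b} \<in> edges G" if "a \<in> A" "b \<in> T" for a b
    using that T(1) by (auto simp: common_nbrs_def)
  have f': "f i \<in> A" if "i < s" for i using f that by (auto simp: bij_betw_def)
  have g': "g j \<in> T" if "j < t" for j using g that by (auto simp: bij_betw_def)
  have conn: "connected_subset G {v}" if "v \<in> verts G" for v
    using that by (auto simp: connected_subset_def)
  have TV: "T \<subseteq> verts G" using T(1) by (auto simp: common_nbrs_def)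
  show ?thesis
  proof (rule has_complete_bipartite_minorI[where P = "\<lambda>i. {f i}" and Q = "\<lambda>j. {g j}"])
    show "connected_subset G {f i}" if "i < s" for i
      using f'[OF that] A(1) by (intro conn) auto
    show "connected_subset G {g j}" if "j < t" for j
      using g'[OF that] TV by (intro conn) auto
    show "{f i} \<inter> {f i'} = {}" if "i < s" "i' < s" "i \<noteq> i'" for i i'
      using f that by (auto simp: bij_betw_def inj_on_def)
    show "{g i} \<inter> {g i'} = {}" if "i < t" "i' < t" "i \<noteq> i'" for i i'
      using g that by (auto simp: bij_betw_def inj_on_def)
    show "{f i} \<inter> {g j} = {}" if "i < s" "j < t" for i j
      using edge[OF f'[OF that(1)] g'[OF that(2)]] irrefl by (auto simp: irreflp_def)
    show "\<exists>u\<in>{f i}. \<exists>v\<in>{g j}. {u, v} \<in> edges G" if "i < s" "j < t" for i j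
      using edge[OF f'[OF that(1)] g'[OF that(2)]] by simp
  qed
qed

lemma symp_edges: "symp (\<lambda>u v. {u, v} \<in> edges G)"
  by (auto simp: symp_def insert_commute)

lemma irreflp_edges_shadow: "irreflp (\<lambda>u v. {u, v} \<in> edges (shadow H))"
  by (auto simp: irreflp_def shadow_def)

text \<open>Since products of weights are nonnegative, this allows the sum over hyperedges to be
  replaced by one over all cliques of the shadow.\<close>

lemma edges_subset_cliques_shadow:
  assumes "uniform_hypergraph k H"
  shows "edges H \<subseteq> cliques (\<lambda>u v. {u, v} \<in> edges (shadow H)) (verts H) k"
  using assms by (auto simp: uniform_hypergraph_def cliques_def shadow_def)

context parameters
begin

text \<open>Every nonempty vertex subset has average degree below \<open>2 ^ (s + t + 1)\<close>, as
  otherwise it contains a clique model; counting cliques by degeneracy puts this number into the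
  exponent.\<close>

lemma sparse_of_minor_free:
  assumes H: "H \<in> minor_free_class k (complete_bipartite s t) n"
  shows "sparse (2 ^ 2 ^ (s + t + 1)) (\<lambda>u v. {u, v} \<in> edges (shadow H)) (verts H)"
proof -
  let ?G = "shadow H" and ?D = "2 ^ (s + t + 1) :: nat"
  have fin: "finite (verts H)" and free: "\<not> has_minor ?G (complete_bipartite s t)"
    using H by (auto simp: minor_free_class_def uniform_hypergraph_def)
  have V: "verts ?G = verts H" by (simp add: shadow_def)
  have "card (cliques (\<lambda>u v. {u, v} \<in> edges ?G) X l) \<le> 2 ^ ?D * card X"
    if X: "X \<subseteq> verts H" and l: "l > 0" for X l
  proof (rule card_cliques_degenerate)
    show "finite X" using X fin by (rule finite_subset)
    fix Y assume Y: "Y \<subseteq> X" "Y \<noteq> {}"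
    have "finite Y" using finite_subset[OF subset_trans[OF Y(1) X] fin] .
    then have "\<not> ?D * card Y \<le> degree_sum (\<lambda>u v. {u, v} \<in> edges ?G) Y"
      using complete_bipartite_minor_of_dense[OF symp_edges irreflp_edges_shadow, of Y H s t]
        free Y X V by auto
    then show "degree_sum (\<lambda>u v. {u, v} \<in> edges ?G) Y \<le> ?D * card Y" by linarith
  qed (rule l)
  moreover have "card (common_nbrs (\<lambda>u v. {u, v} \<in> edges ?G) (verts H) A) \<le> t - 1"
    if "A \<subseteq> verts H" "card A = s" for A
  proof (rule ccontr)
    assume "\<not> ?thesis"
    then have "t \<le> card (common_nbrs (\<lambda>u v. {u, v} \<in> edges ?G) (verts H) A)" by linarith
    then show False
      using complete_bipartite_minor_of_common_nbrs[OF irreflp_edges_shadow, of H A s t]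
        free fin that V by simp
  qed
  ultimately show ?thesis
    using fin r_bounds k by (simp add: sparse_def symp_edges)
qed

lemma minor_free_upper_bound:
  assumes \<delta>: "0 < \<delta>"
  shows "\<exists>N>0. \<forall>n\<ge>N. \<forall>H :: 'a hypergraph. H \<in> minor_free_class k (complete_bipartite s t) n \<longrightarrow>
    spectral_radius k H \<le> (c + \<delta>) * real n powr e"
proof -
  obtain N where N: "N > 0" and bound: "\<And>n adj (V :: 'a set) (x :: 'a \<Rightarrow> real).
      N \<le> n \<Longrightarrow> sparse (2 ^ 2 ^ (s + t + 1)) adj V \<Longrightarrow> card V \<le> n \<Longrightarrow>
      (\<forall>v\<in>V. 0 \<le> x v) \<Longrightarrow> (\<Sum>v\<in>V. x v ^ k) \<le> 1 \<Longrightarrow>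
      k * (\<Sum>F\<in>cliques adj V k. \<Prod>v\<in>F. x v) \<le> (c + \<delta>) * real n powr e"
    using sparse_upper_bound[OF \<delta>, where ?'a = 'a] by metis
  have "spectral_radius k H \<le> (c + \<delta>) * real n powr e"
    if n: "N \<le> n" and H: "H \<in> minor_free_class k (complete_bipartite s t) n"
    for n and H :: "'a hypergraph"
  proof -
    let ?adj = "\<lambda>u v. {u, v} \<in> edges (shadow H)"
    have uni: "uniform_hypergraph k H" and card: "card (verts H) = n"
      using H by (auto simp: minor_free_class_def)
    have fin: "finite (verts H)" using uni by (simp add: uniform_hypergraph_def)
    have "verts H \<noteq> {}" using card N n by auto
    then obtain x where x: "unit_vector k H x" "tensor_form k H x = spectral_radius k H"
      using spectral_radius_attained[OF uni] k by auto
    have "tensor_form k H x \<le> k * (\<Sum>F\<in>cliques ?adj (verts H) k. \<Prod>v\<in>F. x v)"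
      unfolding tensor_form_def
    proof (intro mult_left_mono sum_mono2)
      show "edges H \<subseteq> cliques ?adj (verts H) k"
        using uni by (rule edges_subset_cliques_shadow)
      show "0 \<le> (\<Prod>v\<in>F. x v)" if "F \<in> cliques ?adj (verts H) k - edges H" for F
        using that x(1) by (auto simp: cliques_def unit_vector_def intro!: prod_nonneg)
    qed (use fin in \<open>auto simp: finite_cliques\<close>)
    also have "\<dots> \<le> (c + \<delta>) * real n powr e"
      using x(1) card by (intro bound[OF n sparse_of_minor_free[OF H]]) (auto simp: unit_vector_def)
    finally show ?thesis using x(2) by simp
  qed
  then show ?thesis using N by blast
qed

end

subsection \<open>The extremal graph has no complete bipartite minor\<close>

text \<open>\<open>\<kappa>\<close> is constant on the components of \<open>G - D\<close>. Fewer
  than \<open>s\<close> branch sets meet \<open>D\<close>, so more than \<open>t\<close> avoid it,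
  including some on each side because \<open>s \<le> t\<close>. These are connected, and adjacent
  across the sides, so they share one value of \<open>\<kappa>\<close>; but a class of at most
  \<open>t\<close> vertices has no room for more than \<open>t\<close> disjoint nonempty
  sets.\<close>

lemma no_complete_bipartite_minor:
  fixes \<kappa> :: "'a \<Rightarrow> 'b"
  assumes st: "0 < s" "s \<le> t" and D: "finite D" "card D < s"
    and edge: "\<And>u v. {u, v} \<in> edges G \<Longrightarrow> u \<notin> D \<Longrightarrow> v \<notin> D \<Longrightarrow> \<kappa> u = \<kappa> v"
    and classes: "\<And>i. finite {v \<in> verts G - D. \<kappa> v = i} \<and> card {v \<in> verts G - D. \<kappa> v = i} \<le> t"
  shows "\<not> has_minor G (complete_bipartite s t)"
proof
  let ?M = "complete_bipartite s t"
  assume "has_minor G ?M"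
  then obtain B :: "nat + nat \<Rightarrow> 'a set"
    where conn: "\<And>p. p \<in> verts ?M \<Longrightarrow> connected_subset G (B p)"
      and disj: "disjoint_family_on B (verts ?M)"
      and minor_edge: "\<And>p q. p \<in> verts ?M \<Longrightarrow> q \<in> verts ?M \<Longrightarrow> {p, q} \<in> edges ?M \<Longrightarrow>
        \<exists>u\<in>B p. \<exists>v\<in>B q. {u, v} \<in> edges G"
    unfolding has_minor_def by blast
  have VM: "verts ?M = {..<s} <+> {..<t}" by (simp add: complete_bipartite_def)
  have finM: "finite (verts ?M)" and cardM: "card (verts ?M) = s + t"
    by (simp_all add: VM card_Plus)
  \<comment> \<open>Pigeonhole for disjoint sets that all meet \<open>Z\<close>; applied to the
    branch sets meeting \<open>D\<close>, and at the end to those inside one class of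
    \<open>\<kappa>\<close>.\<close>
  have card_le: "card R \<le> card Z" if "R \<subseteq> verts ?M" "finite Z" "\<And>p. p \<in> R \<Longrightarrow> B p \<inter> Z \<noteq> {}" for R Z
  proof -
    have "\<exists>f. \<forall>p\<in>R. f p \<in> B p \<inter> Z" using that(3) by (intro bchoice) blast
    then obtain f where f: "\<And>p. p \<in> R \<Longrightarrow> f p \<in> B p" "\<And>p. p \<in> R \<Longrightarrow> f p \<in> Z" by blast
    have "inj_on f R"
    proof (rule inj_onI, rule ccontr)
      fix p q assume pq: "p \<in> R" "q \<in> R" "f p = f q" "p \<noteq> q"
      then have "f p \<in> B p \<inter> B q" using f(1)[of p] f(1)[of q] by simp
      moreover have "B p \<inter> B q = {}"
        using disj pq that(1) unfolding disjoint_family_on_def by blast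
      ultimately show False by simp
    qed
    then show ?thesis using f(2) that(2) by (intro card_inj_on_le[of f]) auto
  qed
  define hit where "hit = {p \<in> verts ?M. B p \<inter> D \<noteq> {}}"
  define P where "P = verts ?M - hit"
  have card_hit: "card hit < s"
    using card_le[of hit D] D by (fastforce simp: hit_def)
  have fin_hit: "finite hit" using finM by (simp add: hit_def)
  have "card P = s + t - card hit"
    unfolding P_def using fin_hit cardM by (subst card_Diff_subset) (auto simp: hit_def)
  then have card_P: "t < card P" using card_hit by linarith
  have "\<exists>i<s. Inl i \<in> P"
  proof (rule ccontr)
    assume "\<not> ?thesis"
    then have "Inl ` {..<s} \<subseteq> hit" by (auto simp: P_def VM)
    then have "card (Inl ` {..<s} :: (nat + nat) set) \<le> card hit" using fin_hit by (intro card_mono)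
    then show False using card_hit by (simp add: card_image)
  qed
  then obtain i0 where i0: "i0 < s" "Inl i0 \<in> P" by blast
  have "\<exists>j<t. Inr j \<in> P"
  proof (rule ccontr)
    assume "\<not> ?thesis"
    then have "Inr ` {..<t} \<subseteq> hit" by (auto simp: P_def VM)
    then have "card (Inr ` {..<t} :: (nat + nat) set) \<le> card hit" using fin_hit by (intro card_mono)
    then show False using card_hit st by (simp add: card_image)
  qed
  then obtain j0 where j0: "j0 < t" "Inr j0 \<in> P" by blast
  have PM: "p \<in> verts ?M" "B p \<inter> D = {}" if "p \<in> P" for p
    using that by (auto simp: P_def hit_def)
  have const: "\<kappa> u = \<kappa> v" if p: "p \<in> P" and uv: "u \<in> B p" "v \<in> B p" for p u v
  proof -
    have "(u, v) \<in> {(x, y). x \<in> B p \<and> y \<in> B p \<and> {x, y} \<in> edges G}\<^sup>*"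
      using conn[OF PM(1)[OF p]] uv by (simp add: connected_subset_def)
    then show ?thesis
    proof (induction rule: rtrancl_induct)
      case (step y z)
      then have "y \<notin> D" "z \<notin> D" "{y, z} \<in> edges G" using PM(2)[OF p] by auto
      then show ?case using edge step.IH by simp
    qed simp
  qed
  have same: "\<kappa> u = \<kappa> v" if p: "Inl i \<in> P" "Inr j \<in> P" and u: "u \<in> B (Inl i)" and v: "v \<in> B (Inr j)"
    for i j u v
  proof -
    have "{Inl i, Inr j} \<in> edges ?M"
      using PM(1)[OF p(1)] PM(1)[OF p(2)] by (auto simp: complete_bipartite_def)
    then obtain a b where ab: "a \<in> B (Inl i)" "b \<in> B (Inr j)" "{a, b} \<in> edges G"
      using minor_edge PM(1) p by blast
    then have "a \<notin> D" "b \<notin> D" using PM(2)[OF p(1)] PM(2)[OF p(2)] by auto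
    then have "\<kappa> a = \<kappa> b" using edge ab(3) by blast
    then show ?thesis
      using const[OF p(1) u ab(1)] const[OF p(2) v ab(2)] by simp
  qed
  have ne: "B p \<noteq> {}" if "p \<in> P" for p
    using conn[OF PM(1)[OF that]] by (simp add: connected_subset_def)
  obtain u0 where u0: "u0 \<in> B (Inl i0)" using ne[OF i0(2)] by blast
  obtain v0 where v0: "v0 \<in> B (Inr j0)" using ne[OF j0(2)] by blast
  have "\<kappa> u = \<kappa> u0" if p: "p \<in> P" and u: "u \<in> B p" for p u
  proof (cases p)
    case (Inl i)
    then show ?thesis
      using same[of i j0 u v0] same[of i0 j0 u0 v0] p u i0 j0 u0 v0 by simp
  next
    case (Inr j)
    then show ?thesis
      using same[of i0 j u0 u] p u i0 u0 by simp
  qed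
  then have sub: "B p \<subseteq> {v \<in> verts G - D. \<kappa> v = \<kappa> u0}" if p: "p \<in> P" for p
    using conn[OF PM(1)[OF p]] PM(2)[OF p] p by (auto simp: connected_subset_def)
  have "card P \<le> card {v \<in> verts G - D. \<kappa> v = \<kappa> u0}"
  proof (rule card_le)
    show "P \<subseteq> verts ?M" by (auto simp: P_def)
    show "B p \<inter> {v \<in> verts G - D. \<kappa> v = \<kappa> u0} \<noteq> {}" if "p \<in> P" for p
      using ne[OF that] sub[OF that] by blast
  qed (use classes in blast)
  also have "\<dots> \<le> t" using classes by blast
  finally show False using card_P by simp
qed

text \<open>Defined on the whole type and free of \<open>s\<close>, \<open>t\<close> and
  \<open>n\<close>; on the vertex set it agrees with the edges by
  \<open>edges_extremal_graph_iff\<close>.\<close>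

fun extremal_adj :: "nat + nat \<times> nat \<Rightarrow> nat + nat \<times> nat \<Rightarrow> bool" where
  "extremal_adj (Inl i) (Inl i') \<longleftrightarrow> i \<noteq> i'"
| "extremal_adj (Inr (l, a)) (Inr (l', a')) \<longleftrightarrow> l = l' \<and> a \<noteq> a'"
| "extremal_adj _ _ \<longleftrightarrow> True"

abbreviation (input) dominating :: "nat \<Rightarrow> (nat + nat \<times> nat) set" where
  "dominating s \<equiv> Inl ` {..<s - 1}"

abbreviation (input) clique_part :: "nat \<Rightarrow> nat \<Rightarrow> (nat + nat \<times> nat) set" where
  "clique_part b t \<equiv> Inr ` ({..<b} \<times> {..<t})"

lemma verts_extremal_graph:
  "verts (extremal_graph s t n) = dominating s \<union> clique_part ((n + 1 - s) div t) t"
  by (simp add: extremal_graph_def graph_join_def graph_copies_def complete_graph_def Let_def Plus_def)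

lemma edges_complete_graph:
  "edges (complete_graph q) = {{u, v} | u v. u < q \<and> v < q \<and> u \<noteq> v}"
  by (auto simp: complete_graph_def card_2_iff)

lemma edges_extremal_graph:
  fixes s t n :: nat
  defines "b \<equiv> (n + 1 - s) div t"
  shows "edges (extremal_graph s t n) = {{Inl i, Inl i'} | i i'. i < s - 1 \<and> i' < s - 1 \<and> i \<noteq> i'}
    \<union> {{Inr (l, a), Inr (l, a')} | l a a'. l < b \<and> a < t \<and> a' < t \<and> a \<noteq> a'}
    \<union> {{Inl u, Inr v} | u v. u \<in> {..<s - 1} \<and> v \<in> {..<b} \<times> {..<t}}"
proof -
  have D: "(`) Inl ` edges (complete_graph (s - 1)) =
      {{Inl i, Inl i' :: nat + nat \<times> nat} | i i'. i < s - 1 \<and> i' < s - 1 \<and> i \<noteq> i'}" (is "?D = ?D'")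
  proof (intro equalityI subsetI)
    fix F assume "F \<in> ?D"
    then obtain i i' where "i < s - 1" "i' < s - 1" "i \<noteq> i'" "F = Inl ` {i, i'}"
      unfolding edges_complete_graph by blast
    then show "F \<in> ?D'" unfolding image_insert image_empty by blast
  next
    fix F assume "F \<in> ?D'"
    then obtain i i' where "i < s - 1" "i' < s - 1" "i \<noteq> i'" "F = Inl ` {i, i'}"
      unfolding image_insert image_empty by blast
    then show "F \<in> ?D" unfolding edges_complete_graph by blast
  qed
  have K: "(`) Inr ` {Pair i ` e | i e. i < b \<and> e \<in> edges (complete_graph t)} =
      {{Inr (l, a), Inr (l, a') :: nat + nat \<times> nat} | l a a'. l < b \<and> a < t \<and> a' < t \<and> a \<noteq> a'}"
    (is "?K = ?K'")
  proof (intro equalityI subsetI)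
    fix F assume "F \<in> ?K"
    then obtain l a a' where "l < b" "a < t" "a' < t" "a \<noteq> a'" "F = Inr ` Pair l ` {a, a'}"
      unfolding edges_complete_graph by blast
    then show "F \<in> ?K'" unfolding image_insert image_empty by blast
  next
    fix F assume "F \<in> ?K'"
    then obtain l a a' where "l < b" "a < t" "a' < t" "a \<noteq> a'" "F = Inr ` Pair l ` {a, a'}"
      unfolding image_insert image_empty by blast
    then show "F \<in> ?K" unfolding edges_complete_graph by blast
  qed
  have "edges (extremal_graph s t n) = (`) Inl ` edges (complete_graph (s - 1))
      \<union> (`) Inr ` {Pair i ` e | i e. i < b \<and> e \<in> edges (complete_graph t)}
      \<union> {{Inl u, Inr v} | u v. u \<in> {..<s - 1} \<and> v \<in> {..<b} \<times> {..<t}}"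
    by (simp add: extremal_graph_def graph_join_def graph_copies_def Let_def b_def complete_graph_def)
  then show ?thesis unfolding D K .
qed

lemma edges_extremal_graph_iff:
  assumes "u \<in> verts (extremal_graph s t n)" "v \<in> verts (extremal_graph s t n)"
  shows "{u, v} \<in> edges (extremal_graph s t n) \<longleftrightarrow> extremal_adj u v"
  using assms unfolding verts_extremal_graph edges_extremal_graph
  by (cases "(u, v)" rule: extremal_adj.cases) (auto simp: doubleton_eq_iff)

lemma clique_hypergraph_extremal_graph:
  "clique_hypergraph k (extremal_graph s t n) =
    (dominating s \<union> clique_part ((n + 1 - s) div t) t,
     cliques extremal_adj (dominating s \<union> clique_part ((n + 1 - s) div t) t) k)"
proof -
  have "(\<forall>u\<in>F. \<forall>v\<in>F. u \<noteq> v \<longrightarrow> {u, v} \<in> edges (extremal_graph s t n)) \<longleftrightarrow>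
      (\<forall>u\<in>F. \<forall>v\<in>F. u \<noteq> v \<longrightarrow> extremal_adj u v)" if "F \<subseteq> verts (extremal_graph s t n)" for F
    using that by (intro ball_cong refl) (simp add: edges_extremal_graph_iff subset_iff)
  then have "clique_hypergraph k (extremal_graph s t n) =
      (verts (extremal_graph s t n), cliques extremal_adj (verts (extremal_graph s t n)) k)"
    unfolding clique_hypergraph_def cliques_def by (intro arg_cong2[where f = Pair] Collect_cong conj_cong refl)
  then show ?thesis
    unfolding verts_extremal_graph .
qed

text \<open>The maximum runs over hypergraphs on natural numbers, so the vertices are numbered:
  dominating ones first, then the copies as consecutive blocks of length \<open>t\<close>, so that
  division by \<open>t\<close> recovers the copy.\<close>

definition place :: "nat \<Rightarrow> nat \<Rightarrow> nat + nat \<times> nat \<Rightarrow> nat" where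
  "place s t u = (case u of Inl i \<Rightarrow> i | Inr (l, a) \<Rightarrow> s - 1 + (l * t + a))"

lemma mult_add_eq_imp:
  fixes l a l' a' t :: nat
  assumes "l * t + a = l' * t + a'" "a < t" "a' < t"
  shows "l = l' \<and> a = a'"
proof -
  have "(l * t + a) div t = l" "(l' * t + a') div t = l'"
    using assms(2,3) by simp_all
  then have "l = l'" using assms(1) by simp
  then show ?thesis using assms(1) by simp
qed

lemma inj_on_place: "inj_on (place s t) (dominating s \<union> clique_part b t)"
proof (rule inj_onI)
  fix u v assume uv: "u \<in> dominating s \<union> clique_part b t" "v \<in> dominating s \<union> clique_part b t"
    and eq: "place s t u = place s t v"
  show "u = v"
  proof (cases u; cases v)
    fix p q assume pq: "u = Inr p" "v = Inr q"
    obtain l a l' a' where la: "p = (l, a)" "q = (l', a')" by fastforce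
    have "l * t + a = l' * t + a'" using eq pq la by (simp add: place_def)
    moreover have "a < t" "a' < t" using uv pq la by auto
    ultimately show "u = v" using mult_add_eq_imp[of l t a l' a'] pq la by blast
  qed (use uv eq in \<open>auto simp: place_def\<close>)
qed

lemma place_less:
  assumes "u \<in> dominating s \<union> clique_part ((n + 1 - s) div t) t" "s \<le> n + 1" "0 < s"
  shows "place s t u < n"
proof (cases u)
  case (Inl i)
  then show ?thesis using assms by (auto simp: place_def)
next
  case (Inr p)
  obtain l a where la: "p = (l, a)" by fastforce
  let ?b = "(n + 1 - s) div t"
  have "l < ?b" "a < t" using assms Inr la by auto
  then have "Suc l * t \<le> ?b * t" by (intro mult_right_mono) auto
  also have "\<dots> \<le> n + 1 - s" by simp
  finally have "l * t + a < n + 1 - s" using \<open>a < t\<close> by simp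
  then show ?thesis using Inr la assms by (simp add: place_def)
qed

text \<open>A vector is extended by 0. The copies may leave fewer than \<open>t\<close> of the
  \<open>n\<close> vertices over, and the class asks for exactly \<open>n\<close>; the missing ones
  are added as isolated vertices.\<close>

lemma spectral_radius_mono_verts:
  assumes fin: "finite V'" and V: "V \<subseteq> V'" "V \<noteq> {}" and E: "\<And>F. F \<in> E \<Longrightarrow> F \<subseteq> V \<and> card F = k"
    and k: "0 < k"
  shows "spectral_radius k (V, E) \<le> spectral_radius k (V', E)"
proof -
  have uni: "uniform_hypergraph k (V, E)" "uniform_hypergraph k (V', E)"
    using fin V E by (auto simp: uniform_hypergraph_def intro: finite_subset)
  obtain x where x: "unit_vector k (V, E) x" "tensor_form k (V, E) x = spectral_radius k (V, E)"
    using spectral_radius_attained[OF uni(1)] V k by auto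
  have max: "tensor_form k (V', E) y \<le> spectral_radius k (V', E)" if "unit_vector k (V', E) y" for y
    using spectral_radius_attained[OF uni(2)] V k that by (metis fst_conv subset_empty)
  define y where "y v = (if v \<in> V then x v else 0)" for v
  have "(\<Sum>v\<in>V'. y v ^ k) = (\<Sum>v\<in>V. y v ^ k)"
    using fin V k by (intro sum.mono_neutral_right) (auto simp: y_def)
  also have "\<dots> = (\<Sum>v\<in>V. x v ^ k)" by (intro sum.cong) (auto simp: y_def)
  finally have "unit_vector k (V', E) y"
    using x(1) by (auto simp: unit_vector_def y_def)
  moreover have "tensor_form k (V', E) y = tensor_form k (V, E) x"
    unfolding tensor_form_def y_def using E
    by (intro arg_cong2[where f = "(*)"] sum.cong prod.cong refl) auto
  ultimately show ?thesis using max x(2) by metis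
qed

lemma extremal_in_minor_free_class:
  assumes s: "2 \<le> s" and st: "s \<le> t" and n: "s \<le> n + 1" and k: "0 < k"
  shows "\<exists>H \<in> minor_free_class k (complete_bipartite s t) n.
    spectral_radius k (clique_hypergraph k (extremal_graph s t n)) \<le> spectral_radius k (H :: nat hypergraph)"
proof -
  define V where "V = dominating s \<union> clique_part ((n + 1 - s) div t) t"
  define E where "E = cliques extremal_adj V k"
  define f where "f = place s t"
  have X: "clique_hypergraph k (extremal_graph s t n) = (V, E)"
    by (simp add: clique_hypergraph_extremal_graph V_def E_def)
  have finV: "finite V" by (simp add: V_def)
  have E: "F \<subseteq> V" "card F = k" "\<And>u v. u \<in> F \<Longrightarrow> v \<in> F \<Longrightarrow> u \<noteq> v \<Longrightarrow> extremal_adj u v"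
    if "F \<in> E" for F using that by (auto simp: E_def cliques_def)
  have inj: "inj_on f V" unfolding f_def V_def by (rule inj_on_place)
  have range: "f ` V \<subseteq> {..<n}" using place_less n s by (fastforce simp: f_def V_def)
  have "Inl 0 \<in> V" using s by (simp add: V_def)
  then have ne: "V \<noteq> {}" by blast
  let ?H = "({..<n}, (`) f ` E)"
  have fE: "f ` F \<subseteq> f ` V \<and> card (f ` F) = k" if "F \<in> E" for F
    using E(1,2)[OF that] inj by (auto simp: card_image inj_on_subset)
  have "spectral_radius k (V, E) = spectral_radius k (f ` V, (`) f ` E)"
    using spectral_radius_rename[of f "(V, E)" k] inj E(1) by simp
  also have "\<dots> \<le> spectral_radius k ?H"
  proof (rule spectral_radius_mono_verts)
    fix F assume "F \<in> (`) f ` E"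
    then show "F \<subseteq> f ` V \<and> card F = k" using fE by (elim imageE) simp
  qed (use range ne k in auto)
  finally have "spectral_radius k (V, E) \<le> spectral_radius k ?H" .
  moreover have "uniform_hypergraph k ?H"
    using fE range by (fastforce simp: uniform_hypergraph_def)
  \<comment> \<open>Outside the first \<open>s - 1\<close> numbers, \<open>\<kappa>\<close> is the
    number of the block; the added isolated vertices fall into a last, incomplete block.\<close>
  moreover have "\<not> has_minor (shadow ?H) (complete_bipartite s t)"
  proof (rule no_complete_bipartite_minor[where D = "{..<s - 1}" and \<kappa> = "\<lambda>w. (w - (s - 1)) div t"])
    fix u v assume "{u, v} \<in> edges (shadow ?H)" and out: "u \<notin> {..<s - 1}" "v \<notin> {..<s - 1}"
    then obtain F where F: "F \<in> E" "u \<in> f ` F" "v \<in> f ` F"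
      by (auto simp: shadow_def doubleton_eq_iff)
    then obtain p q where pq: "p \<in> F" "q \<in> F" "u = f p" "v = f q" by blast
    have "p \<in> V" "q \<in> V" using pq E(1)[OF F(1)] by auto
    then obtain l a l' a' where la: "p = Inr (l, a)" "q = Inr (l', a')" "a < t" "a' < t"
      using out pq(3,4) by (auto simp: V_def f_def place_def)
    have "l = l'" using E(3)[OF F(1) pq(1,2)] la by (cases "p = q") auto
    then show "(u - (s - 1)) div t = (v - (s - 1)) div t"
      using pq(3,4) la by (simp add: f_def place_def)
  next
    fix i
    have "{v \<in> verts (shadow ?H) - {..<s - 1}. (v - (s - 1)) div t = i}
        \<subseteq> {s - 1 + i * t..<s - 1 + i * t + t}"
    proof
      fix v assume "v \<in> {v \<in> verts (shadow ?H) - {..<s - 1}. (v - (s - 1)) div t = i}"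
      then have v: "s - 1 \<le> v" "(v - (s - 1)) div t = i" by auto
      then have "i * t \<le> v - (s - 1)" by (metis div_times_less_eq_dividend)
      moreover have "v - (s - 1) < i * t + t"
        using v(2) s st by (metis add.commute dividend_less_times_div gr0I le_zero_eq mult.commute not_numeral_le_zero)
      ultimately show "v \<in> {s - 1 + i * t..<s - 1 + i * t + t}"
        unfolding atLeastLessThan_iff using v(1) by linarith
    qed
    then show "finite {v \<in> verts (shadow ?H) - {..<s - 1}. (v - (s - 1)) div t = i} \<and>
        card {v \<in> verts (shadow ?H) - {..<s - 1}. (v - (s - 1)) div t = i} \<le> t"
      by (metis (no_types, lifting) add_diff_cancel_left' card_atLeastLessThan card_mono finite_atLeastLessThan finite_subset)
  qed (use s st in auto)
  ultimately show ?thesis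
    unfolding X by (intro bexI[of _ ?H]) (auto simp: minor_free_class_def)
qed

subsection \<open>The spectral radius of the extremal hypergraph\<close>

context parameters
begin

abbreviation extremal_verts :: "nat \<Rightarrow> (nat + nat \<times> nat) set" where
  "extremal_verts b \<equiv> dominating s \<union> clique_part b t"

lemma dominating_disjoint: "dominating s \<inter> clique_part b t = {}"
  by auto

lemma card_dominating: "card (dominating s) = s - 1"
  and card_clique_part: "card (clique_part b t) = b * t"
  by (simp_all add: card_image)

text \<open>Among the copies, a vertex is adjacent only to the other \<open>t - 1\<close> vertices
  of its own copy, whatever \<open>A\<close> is.\<close>

lemma admissible_extremal: "admissible extremal_adj (dominating s) (clique_part b t)"
  unfolding admissible_def
proof (intro conjI ballI allI impI)
  show "degree_in extremal_adj (dominating s) v \<le> s - 1" for v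
    using card_mono[of "dominating s" "{u \<in> dominating s. extremal_adj v u}"] card_dominating
    by (auto simp: degree_in_def)
  fix v A assume "v \<in> clique_part b t"
  then obtain l a where v: "v = Inr (l, a)" "l < b" "a < t" by auto
  let ?N = "{w \<in> clique_part b t. extremal_adj v w \<and> (\<forall>u\<in>A. extremal_adj w u)}"
  have "?N \<subseteq> (\<lambda>a. Inr (l, a)) ` ({..<t} - {a})"
    using v(1) by auto
  then have "card ?N \<le> card ((\<lambda>a. Inr (l, a) :: nat + nat \<times> nat) ` ({..<t} - {a}))"
    by (intro card_mono) auto
  also have "\<dots> = t - 1"
    using v(3) by (subst card_image) (auto simp: inj_on_def)
  finally show "card ?N \<le> t - 1" .
qed (auto simp: dominating_disjoint)

lemma card_main_cliques_extremal:
  "((s - 1) choose (r - 1)) * (b * (t choose m))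
    \<le> card (main_cliques extremal_adj (dominating s) (clique_part b t))"
proof -
  let ?A = "{A. A \<subseteq> {..<s - 1} \<and> card A = r - 1}" and ?K = "{K. K \<subseteq> {..<t} \<and> card K = m}"
  define \<phi> :: "nat set \<times> nat \<times> nat set \<Rightarrow> (nat + nat \<times> nat) set"
    where "\<phi> = (\<lambda>(A, l, K). Inl ` A \<union> Inr ` ({l} \<times> K))"
  have cardA: "card ?A = (s - 1) choose (r - 1)"
    using n_subsets[of "{..<s - 1}" "r - 1"] by simp
  have cardK: "card ?K = t choose m"
    using n_subsets[of "{..<t}" m] by simp
  have "card (?A \<times> {..<b} \<times> ?K) \<le> card (main_cliques extremal_adj (dominating s) (clique_part b t))"
  proof (rule card_inj_on_le[where f = \<phi>])
    show "finite (main_cliques extremal_adj (dominating s) (clique_part b t))"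
      by (simp add: main_cliques_def finite_cliques)
    show "inj_on \<phi> (?A \<times> {..<b} \<times> ?K)"
    proof (rule inj_onI)
      fix z z' assume z: "z \<in> ?A \<times> {..<b} \<times> ?K" and z': "z' \<in> ?A \<times> {..<b} \<times> ?K" and eq: "\<phi> z = \<phi> z'"
      obtain A l K A' l' K' where zz: "z = (A, l, K)" "z' = (A', l', K')"
        by (metis prod_cases3)
      have "Inl -` \<phi> z = A" "Inl -` \<phi> z' = A'" "Inr -` \<phi> z = {l} \<times> K" "Inr -` \<phi> z' = {l'} \<times> K'"
        by (auto simp: \<phi>_def zz)
      then have "A = A'" "{l} \<times> K = {l'} \<times> K'" using eq by simp_all
      \<comment> \<open>This is where \<open>m \<ge> 1\<close> enters: the clique must have a vertex
        in its copy to determine \<open>l\<close>.\<close>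
      moreover have "K \<noteq> {}" using z m_bounds by (auto simp: zz)
      ultimately show "z = z'" using zz by (auto simp: times_eq_iff)
    qed
    show "\<phi> ` (?A \<times> {..<b} \<times> ?K) \<subseteq> main_cliques extremal_adj (dominating s) (clique_part b t)"
    proof (rule image_subsetI)
      fix z assume "z \<in> ?A \<times> {..<b} \<times> ?K"
      then obtain A l K where z: "z = (A, l, K)" "A \<subseteq> {..<s - 1}" "card A = r - 1" "l < b" "K \<subseteq> {..<t}" "card K = m"
        by auto
      have fin: "finite A" "finite K" using z by (auto intro: finite_subset)
      have \<phi>: "\<phi> z = Inl ` A \<union> Inr ` ({l} \<times> K)" by (simp add: \<phi>_def z(1))
      have "card (\<phi> z) = card (Inl ` A :: (nat + nat \<times> nat) set) + card (Inr ` ({l} \<times> K) :: (nat + nat \<times> nat) set)"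
        unfolding \<phi> using fin by (intro card_Un_disjoint) auto
      also have "\<dots> = r - 1 + m" using z by (simp add: card_image card_cartesian_product)
      finally have "card (\<phi> z) = k" using m_bounds by simp
      moreover have "\<phi> z \<inter> dominating s = Inl ` A" unfolding \<phi> using z(2-6) by auto
      then have "card (\<phi> z \<inter> dominating s) = r - 1" using z by (simp add: card_image)
      moreover have "\<phi> z \<subseteq> dominating s \<union> clique_part b t" unfolding \<phi> using z(2-6) by auto
      moreover have "\<forall>u\<in>\<phi> z. \<forall>v\<in>\<phi> z. u \<noteq> v \<longrightarrow> extremal_adj u v" unfolding \<phi> by auto
      ultimately show "\<phi> z \<in> main_cliques extremal_adj (dominating s) (clique_part b t)"
        by (simp add: main_cliques_def cliques_def)
    qed
  qed
  then show ?thesis unfolding card_cartesian_product cardA cardK by simp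
qed

lemma extremal_uniform: "uniform_hypergraph k (extremal_verts b, cliques extremal_adj (extremal_verts b) k)"
  by (auto simp: uniform_hypergraph_def cliques_def)

text \<open>The test vector is constant on both parts, with mass \<open>e\<close> on the dominating
  vertices and \<open>1 - e\<close> on the copies. As \<open>e\<close> and \<open>1 - e\<close> are
  in the ratio \<open>r - 1\<close> to \<open>m\<close>, the \<open>k\<close>-th powers of the two
  values have ratio \<open>\<gamma> * real (b * t)\<close>, the equality case of the weighted
  inequality. Keeping only the main cliques already gives the bound.\<close>

lemma extremal_lower_bound:
  assumes b: "0 < b"
  shows "c * real (b * t) powr e
    \<le> spectral_radius k (extremal_verts b, cliques extremal_adj (extremal_verts b) k)"
    (is "_ \<le> spectral_radius k (?V, ?E)")
proof -
  let ?L = "dominating s" and ?W = "clique_part b t" and ?N = "real (b * t)"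
  let ?M = "main_cliques extremal_adj ?L ?W"
  have N: "?N > 0" using b st s by simp
  define a where "a = (e / (s - 1)) powr (1 / k)"
  define y where "y = ((1 - e) / ?N) powr (1 / k)"
  have a0: "0 < e / real (s - 1)" and y0: "0 < (1 - e) / ?N"
    using e_pos e_less s N by simp_all
  have ay: "0 < a" "0 < y"
    unfolding a_def y_def powr_gt_zero using a0 y0 by (simp_all only: less_imp_neq[symmetric] not_False_eq_True)
  define x :: "nat + nat \<times> nat \<Rightarrow> real" where "x = case_sum (\<lambda>_. a) (\<lambda>_. y)"
  have kk: "real k / real k = 1" using k by simp
  have "a ^ k = e / (s - 1)" "y ^ k = (1 - e) / ?N"
    unfolding a_def y_def powr_divide_power[OF a0] powr_divide_power[OF y0] kk
    by (rule powr_one[OF less_imp_le[OF a0]]) (rule powr_one[OF less_imp_le[OF y0]])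
  moreover have "(\<Sum>v\<in>?V. x v ^ k) = (\<Sum>v\<in>?L. x v ^ k) + (\<Sum>v\<in>?W. x v ^ k)"
    by (intro sum.union_disjoint) auto
  moreover have "(\<Sum>v\<in>?L. x v ^ k) = (\<Sum>v\<in>?L. a ^ k)" "(\<Sum>v\<in>?W. x v ^ k) = (\<Sum>v\<in>?W. y ^ k)"
    by (rule sum.cong; auto simp: x_def)+
  ultimately have "(\<Sum>v\<in>?V. x v ^ k) = real (s - 1) * (e / (s - 1)) + ?N * ((1 - e) / ?N)"
    by (simp only: sum_constant card_dominating card_clique_part)
  also have "\<dots> = 1"
  proof -
    have "real (s - 1) \<noteq> 0" "?N \<noteq> 0" using s N by linarith+
    then show ?thesis by (simp del: of_nat_mult of_nat_diff)
  qed
  finally have unit: "unit_vector k (?V, ?E) x"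
    using ay by (auto simp: unit_vector_def x_def split: sum.split)
  have prod: "(\<Prod>v\<in>F. x v) = a ^ (r - 1) * y ^ m" if F: "F \<in> ?M" for F
  proof -
    have F': "F \<subseteq> ?L \<union> ?W" "card F = k" "card (F \<inter> ?L) = r - 1"
      using F by (simp_all add: main_cliques_def cliques_def)
    have finF: "finite F" using F'(1) by (rule finite_subset) simp
    have cW: "card (F \<inter> ?W) = m"
      using card_Int_add_card_Int[OF finF F'(1) dominating_disjoint] F' m_bounds(3) by linarith
    have "(\<Prod>v\<in>F. x v) = (\<Prod>v\<in>(F \<inter> ?L) \<union> (F \<inter> ?W). x v)"
      using F'(1) by (intro prod.cong) auto
    also have "\<dots> = (\<Prod>v\<in>F \<inter> ?L. x v) * (\<Prod>v\<in>F \<inter> ?W. x v)"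
      using finF by (intro prod.union_disjoint) auto
    also have "(\<Prod>v\<in>F \<inter> ?L. x v) = (\<Prod>v\<in>F \<inter> ?L. a)"
      by (intro prod.cong) (auto simp: x_def)
    also have "(\<Prod>v\<in>F \<inter> ?W. x v) = (\<Prod>v\<in>F \<inter> ?W. y)"
      by (intro prod.cong) (auto simp: x_def)
    finally show ?thesis using F'(3) cW by (simp only: prod_constant)
  qed
  \<comment> \<open>Absorption rewrites the number of main cliques as
    \<open>\<Delta> * ?N / m\<close>: \<open>\<Delta>\<close> at each vertex of the copies, and each
    clique counted \<open>m\<close> times.\<close>
  have "m * (t choose m) = t * ((t - 1) choose (m - 1))"
    using m_bounds by (intro times_binomial_minus1_eq) simp
  then have "m * (((s - 1) choose (r - 1)) * (b * (t choose m))) = \<Delta> * (b * t)"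
    by (simp add: \<Delta>_def mult_ac)
  then have "\<Delta> * (b * t) \<le> m * card ?M"
    using mult_left_mono[OF card_main_cliques_extremal[of b], of m] by (simp only: zero_le)
  then have "real (\<Delta> * (b * t)) \<le> real (m * card ?M)"
    by (rule of_nat_mono)
  then have count: "\<Delta> * ?N / m \<le> card ?M"
    using m_bounds by (simp add: field_simps)
  have "c * ?N powr e = k * (\<Delta> * ?N / m) * (a ^ (r - 1) * y ^ m)"
  proof -
    have "a ^ (r - 1) = (e / (s - 1)) powr e"
      unfolding a_def using powr_divide_power[OF a0, of k "r - 1"] by (simp add: e_def)
    moreover have "y ^ m = ((1 - e) / ?N) powr (1 - e)"
      unfolding y_def using powr_divide_power[OF y0, of k m] by (simp add: e_eq)
    moreover have "((1 - e) / ?N) powr (1 - e) = (1 - e) / ?N * (?N / (1 - e)) powr e"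
    proof -
      have "((1 - e) / ?N) powr (1 - e) = ((1 - e) / ?N) powr 1 / ((1 - e) / ?N) powr e"
        by (rule powr_diff)
      also have "\<dots> = (1 - e) / ?N * (?N / (1 - e)) powr e"
        using y0 e_less N by (simp add: powr_divide)
      finally show ?thesis .
    qed
    ultimately have "a ^ (r - 1) * y ^ m
        = (1 - e) / ?N * ((e / (s - 1)) powr e * (?N / (1 - e)) powr e)" by simp
    also have "(e / (s - 1)) powr e * (?N / (1 - e)) powr e = (\<gamma> * ?N) powr e"
    proof -
      have "\<gamma> = e / (s - 1) / (1 - e)"
        using k by (simp add: \<gamma>_def e_eq) (simp add: e_def flip: e_eq)
      then have "\<gamma> * ?N = e / (s - 1) * (?N / (1 - e))" by simp
      then show ?thesis
        using a0 N e_less by (simp add: powr_mult[symmetric] del: of_nat_mult)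
    qed
    finally have "k * (\<Delta> * ?N / m) * (a ^ (r - 1) * y ^ m)
        = k * (\<Delta> * ?N / m) * ((1 - e) / ?N * (\<gamma> * ?N) powr e)" by simp
    also have "\<dots> = \<Delta> * (\<gamma> * ?N) powr e"
      using N k m_bounds by (simp add: e_eq)
    also have "\<dots> = c * ?N powr e"
      using \<gamma>_pos N by (simp add: c_def powr_mult del: of_nat_mult)
    finally show ?thesis by simp
  qed
  also have "\<dots> \<le> real k * real (card ?M) * (a ^ (r - 1) * y ^ m)"
  proof (rule mult_right_mono)
    show "real k * (\<Delta> * ?N / m) \<le> real k * real (card ?M)"
      using count by (rule mult_left_mono) simp
  qed (use ay in simp)
  also have "\<dots> = k * (\<Sum>F\<in>?M. \<Prod>v\<in>F. x v)"
    using prod by simp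
  also have "\<dots> \<le> k * (\<Sum>F\<in>?E. \<Prod>v\<in>F. x v)"
    using unit
    by (intro mult_left_mono sum_mono2)
      (auto simp: main_cliques_def finite_cliques cliques_def unit_vector_def intro!: prod_nonneg)
  also have "\<dots> = tensor_form k (?V, ?E) x" by (simp add: tensor_form_def)
  also have "\<dots> \<le> spectral_radius k (?V, ?E)"
  proof -
    have "?V \<noteq> {}" using unit by (auto simp: unit_vector_def)
    then show ?thesis
      using spectral_radius_attained[OF extremal_uniform[of b]] unit k by (metis fst_conv gr0I not_numeral_le_zero)
  qed
  finally show ?thesis .
qed

text \<open>A clique through \<open>v\<close> lies in the copy of \<open>v\<close> together with the
  dominating set.\<close>

lemma card_extremal_cliques_at:
  assumes v: "v \<in> clique_part b t"
  shows "card {F \<in> cliques extremal_adj (extremal_verts b) k. v \<in> F} \<le> 2 ^ (s + t)"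
proof -
  obtain l a where la: "v = Inr (l, a)" using v by auto
  let ?U = "dominating s \<union> Inr ` ({l} \<times> {..<t})"
  have "{F \<in> cliques extremal_adj (extremal_verts b) k. v \<in> F} \<subseteq> Pow ?U"
  proof
    fix F assume F: "F \<in> {F \<in> cliques extremal_adj (extremal_verts b) k. v \<in> F}"
    then have cl: "F \<subseteq> extremal_verts b" "\<And>w. w \<in> F \<Longrightarrow> w \<noteq> v \<Longrightarrow> extremal_adj v w" and vF: "v \<in> F"
      by (auto simp: cliques_def)
    have "w \<in> ?U" if w: "w \<in> F" for w
      using subsetD[OF cl(1) w] subsetD[OF cl(1) vF] cl(2)[OF w] la by (cases "w = v") auto
    then show "F \<in> Pow ?U" by blast
  qed
  then have "card {F \<in> cliques extremal_adj (extremal_verts b) k. v \<in> F} \<le> card (Pow ?U)"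
    by (intro card_mono) auto
  also have "\<dots> = 2 ^ card ?U" by (intro card_Pow) simp
  also have "\<dots> \<le> 2 ^ (s + t)"
  proof (rule power_increasing)
    have "card ?U \<le> card (dominating s) + card (Inr ` ({l} \<times> {..<t}) :: (nat + nat \<times> nat) set)"
      by (rule card_Un_le)
    also have "\<dots> \<le> s + t" by (simp add: card_image card_cartesian_product)
    finally show "card ?U \<le> s + t" .
  qed simp
  finally show ?thesis .
qed

text \<open>Such a clique has at least \<open>m + 1\<close> vertices in the copies, so scaling by
  \<open>\<beta>\<close> gains one factor \<open>\<beta> = ?N powr (1 / k)\<close> more than in the
  main term. The bounded number of cliques at each vertex of a copy takes the place of the dyadic
  levels.\<close>

lemma extremal_few_dominating:
  fixes x :: "nat + nat \<times> nat \<Rightarrow> real"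
  assumes b: "0 < b" and x: "unit_vector k (extremal_verts b, E) x"
  shows "k * (\<Sum>F\<in>{F \<in> cliques extremal_adj (extremal_verts b) k. card (F \<inter> dominating s) + 1 < r}.
      \<Prod>v\<in>F. x v) \<le> 2 ^ (s + t) * real (b * t) powr (e - 1 / k)"
proof -
  let ?L = "dominating s" and ?W = "clique_part b t" and ?N = "real (b * t)"
  let ?S = "{F \<in> cliques extremal_adj (extremal_verts b) k. card (F \<inter> ?L) + 1 < r}"
  have "1 \<le> b * t" using b st s by (simp add: Suc_leI)
  then have N: "?N \<ge> 1" by linarith
  define \<beta> where "\<beta> = ?N powr (1 / k)"
  have \<beta>1: "1 \<le> \<beta>" unfolding \<beta>_def using N by (intro ge_one_powr_ge_zero) auto
  have \<beta>k: "\<beta> ^ k = ?N"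
    unfolding \<beta>_def using powr_divide_power[of ?N k k] N k by simp
  have finS: "finite ?S" by (simp add: finite_cliques)
  have S: "F \<subseteq> ?L \<union> ?W \<and> card F = k \<and> m + 1 \<le> card (F \<inter> ?W)" if F: "F \<in> ?S" for F
  proof -
    have F': "F \<subseteq> ?L \<union> ?W" "card F = k" "card (F \<inter> ?L) + 1 < r"
      using F by (simp_all add: cliques_def)
    have finF: "finite F" using F'(1) by (rule finite_subset) simp
    have "m + 1 \<le> card (F \<inter> ?W)"
      using card_Int_add_card_Int[OF finF F'(1) dominating_disjoint] F' m_bounds(3) by linarith
    then show ?thesis using F' by simp
  qed
  have at: "card {F \<in> ?S. v \<in> F} \<le> 2 ^ (s + t)" if "v \<in> ?W" for v
  proof -
    have "card {F \<in> ?S. v \<in> F} \<le> card {F \<in> cliques extremal_adj (extremal_verts b) k. v \<in> F}"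
      by (intro card_mono) (auto simp: finite_cliques)
    then show ?thesis using card_extremal_cliques_at[OF that] by linarith
  qed
  have "?S \<subseteq> (\<Union>v\<in>?W. {F \<in> ?S. v \<in> F})"
  proof
    fix F assume F: "F \<in> ?S"
    then have "F \<inter> ?W \<noteq> {}" using S[OF F] by (metis Suc_eq_plus1 card.empty not_less_eq_eq zero_le)
    then show "F \<in> (\<Union>v\<in>?W. {F \<in> ?S. v \<in> F})" using F by blast
  qed
  then have "card ?S \<le> card (\<Union>v\<in>?W. {F \<in> ?S. v \<in> F})"
    by (intro card_mono finite_subset[OF _ finS]) auto
  also have "\<dots> \<le> (\<Sum>v\<in>?W. card {F \<in> ?S. v \<in> F})"
    by (intro card_UN_le) simp
  also have "\<dots> \<le> (\<Sum>v\<in>?W. 2 ^ (s + t))"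
    by (intro sum_mono at)
  also have "\<dots> = b * t * 2 ^ (s + t)"
    by (simp only: sum_constant card_clique_part of_nat_id)
  finally have "real (card ?S) \<le> real (b * t * 2 ^ (s + t))" by (rule of_nat_mono)
  then have card_S: "real (card ?S) \<le> ?N * 2 ^ (s + t)" by simp
  have x0: "0 \<le> x v" if "v \<in> ?L \<union> ?W" for v
    using x that by (simp add: unit_vector_def)
  have S_power: "F \<subseteq> ?L \<union> ?W \<and> card F = k \<and> \<beta> ^ (m + 1) \<le> \<beta> ^ card (F \<inter> ?W)"
    if F: "F \<in> ?S" for F
    using S[OF F] power_increasing[OF _ \<beta>1, of "m + 1" "card (F \<inter> ?W)"] by blast
  have at_large: "real (card {F \<in> ?S. u \<in> F}) \<le> ?N * 2 ^ (s + t)" for u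
  proof -
    have "card {F \<in> ?S. u \<in> F} \<le> card ?S" using finS by (intro card_mono) auto
    then show ?thesis using card_S by linarith
  qed
  have at_small: "real (card {F \<in> ?S. v \<in> F}) \<le> 2 ^ (s + t)" if "v \<in> ?W" for v
    using of_nat_mono[OF at[OF that], where 'a = real] by (simp only: of_nat_power of_nat_numeral)
  have pos: "0 < k" "0 < \<beta>" using k \<beta>1 by linarith+
  have "\<beta> ^ (m + 1) * (k * (\<Sum>F\<in>?S. \<Prod>v\<in>F. x v))
      \<le> (?N * 2 ^ (s + t)) * (\<Sum>u\<in>?L. x u ^ k) + \<beta> ^ k * 2 ^ (s + t) * (\<Sum>v\<in>?W. x v ^ k)"
    by (rule weighted_sum_prod_le[OF _ _ dominating_disjoint x0 pos S_power at_large at_small])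
      (simp_all only: finite_imageI finite_lessThan finite_cartesian_product)
  also have "\<dots> = ?N * 2 ^ (s + t) * ((\<Sum>u\<in>?L. x u ^ k) + (\<Sum>v\<in>?W. x v ^ k))"
    by (simp add: \<beta>k distrib_left)
  also have "(\<Sum>u\<in>?L. x u ^ k) + (\<Sum>v\<in>?W. x v ^ k) = (\<Sum>v\<in>?L \<union> ?W. x v ^ k)"
    by (intro sum.union_disjoint[symmetric]) auto
  also have "\<dots> = 1" using x by (simp add: unit_vector_def)
  finally have "k * (\<Sum>F\<in>?S. \<Prod>v\<in>F. x v) \<le> ?N * 2 ^ (s + t) / \<beta> ^ (m + 1)"
    using \<beta>1 by (simp add: field_simps)
  also have "\<beta> ^ (m + 1) = ?N powr (real (m + 1) / k)"
    unfolding \<beta>_def using N by (intro powr_divide_power) simp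
  also have "?N * 2 ^ (s + t) / ?N powr (real (m + 1) / k) = 2 ^ (s + t) * (?N powr 1 / ?N powr (real (m + 1) / k))"
    using N by simp
  also have "?N powr 1 / ?N powr (real (m + 1) / k) = ?N powr (1 - real (m + 1) / k)"
    by (rule powr_diff[symmetric])
  also have "1 - real (m + 1) / k = e - 1 / k"
    by (simp add: e_eq add_divide_distrib)
  finally show ?thesis .
qed

text \<open>The role of \<open>L\<close> is now played by the dominating set, which does not depend
  on \<open>x\<close>. The bound therefore records its mass \<open>p x\<close>, and
  \<open>\<mu>\<close> is left free to locate that mass.\<close>

lemma extremal_upper_bound:
  fixes x :: "nat + nat \<times> nat \<Rightarrow> real"
  defines "p y \<equiv> \<Sum>u\<in>dominating s. y u ^ k"
  assumes b: "0 < b" and \<mu>: "0 < \<mu>"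
    and x: "unit_vector k (extremal_verts b, cliques extremal_adj (extremal_verts b) k) x"
  shows "tensor_form k (extremal_verts b, cliques extremal_adj (extremal_verts b) k) x
    \<le> c * real (b * t) powr e * (\<mu> powr (e - 1) * (p x + \<mu> * (1 - p x)))
      + 2 ^ (s + t) * real (b * t) powr (e - 1 / k) + real k * 2 ^ s"
proof -
  let ?L = "dominating s" and ?W = "clique_part b t" and ?C = "cliques extremal_adj (extremal_verts b) k"
  let ?M = "main_cliques extremal_adj ?L ?W" and ?S = "{F \<in> ?C. card (F \<inter> ?L) + 1 < r}"
    and ?R = "{F \<in> ?C. r \<le> card (F \<inter> ?L)}"
  define f where "f F = (\<Prod>v\<in>F. x v)" for F
  have x0: "0 \<le> x v" if "v \<in> ?L \<union> ?W" for v using x that by (simp add: unit_vector_def)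
  have x1: "x v \<le> 1" if v: "v \<in> ?L \<union> ?W" for v
  proof -
    have "x v ^ k \<le> (\<Sum>v\<in>?L \<union> ?W. x v ^ k)"
      using x0 v by (intro member_le_sum) auto
    then have "x v ^ k \<le> 1" using x by (simp add: unit_vector_def)
    then show ?thesis using x0[OF v] k by (simp add: power_le_one_iff)
  qed
  have f0: "0 \<le> f F" if "F \<in> ?C" for F
    unfolding f_def using that x0 by (intro prod_nonneg) (auto simp: cliques_def)
  have sum1: "p x + (\<Sum>v\<in>?W. x v ^ k) = 1"
  proof -
    have "p x + (\<Sum>v\<in>?W. x v ^ k) = (\<Sum>v\<in>?L \<union> ?W. x v ^ k)"
      unfolding p_def by (intro sum.union_disjoint[symmetric]) auto
    then show ?thesis using x by (simp add: unit_vector_def)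
  qed
  define G where "G i = (if i = 0 then ?M else if i = 1 then ?S else ?R)" for i :: nat
  have "sum f ?C \<le> (\<Sum>i\<in>{0, 1, 2}. sum f (G i))"
  proof (rule sum_le_sum_cover[OF _ _ _ _ f0])
    show "finite ?C" by (simp add: finite_cliques)
    show "G i \<subseteq> ?C" for i by (auto simp: G_def main_cliques_def)
    fix F assume "F \<in> ?C"
    then have "F \<in> G 0 \<or> F \<in> G 1 \<or> F \<in> G 2"
      using r_bounds(1) by (auto simp: G_def main_cliques_def)
    then show "\<exists>i\<in>{0, 1, 2}. F \<in> G i" by blast
  qed auto
  then have "sum f ?C \<le> sum f ?M + sum f ?S + sum f ?R"
    by (simp add: G_def)
  then have "k * sum f ?C \<le> k * (sum f ?M + sum f ?S + sum f ?R)"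
    by (rule mult_left_mono) simp
  moreover have "k * sum f ?M \<le> c * real (b * t) powr e * (\<mu> powr (e - 1) * (p x + \<mu> * (1 - p x)))"
  proof -
    have q: "(\<Sum>v\<in>?W. x v ^ k) = 1 - p x" using sum1 by linarith
    have "k * sum f ?M \<le> c * real (b * t) powr e
        * (\<mu> powr (e - 1) * ((\<Sum>u\<in>?L. x u ^ k) + \<mu> * (\<Sum>v\<in>?W. x v ^ k)))"
      unfolding f_def using b st s x0 card_clique_part \<mu>
      by (intro main_term_bound admissible_extremal) auto
    then show ?thesis unfolding q p_def .
  qed
  moreover have "k * sum f ?S \<le> 2 ^ (s + t) * real (b * t) powr (e - 1 / k)"
    unfolding f_def using b x by (rule extremal_few_dominating)
  moreover have "k * sum f ?R \<le> real k * 2 ^ s"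
  proof (rule mult_left_mono)
    \<comment> \<open>There are only \<open>s - 1\<close> dominating vertices, so \<open>r\<close>
      of them in one clique force \<open>r = k\<close>, and the whole clique is dominating.\<close>
    have "?R \<subseteq> Pow ?L"
    proof
      fix F assume F: "F \<in> ?R"
      then have F': "F \<subseteq> ?L \<union> ?W" "card F = k" "r \<le> card (F \<inter> ?L)" by (simp_all add: cliques_def)
      have finF: "finite F" using F'(1) by (rule finite_subset) simp
      have "card (F \<inter> ?L) \<le> s - 1"
        using card_mono[of ?L "F \<inter> ?L"] card_dominating by simp
      then have "r = k" using F'(3) s by (auto simp: r_def)
      moreover have "card (F \<inter> ?L) \<le> card F" using finF by (intro card_mono) auto
      ultimately have "card (F \<inter> ?L) = card F" using F'(2,3) by linarith
      then have "F \<inter> ?L = F" by (intro card_subset_eq[OF finF]) auto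
      then show "F \<in> Pow ?L" by blast
    qed
    then have "card ?R \<le> card (Pow ?L)" by (intro card_mono) auto
    also have "\<dots> = 2 ^ (s - 1)" by (simp only: card_Pow card_dominating finite_imageI finite_lessThan)
    also have "\<dots> \<le> 2 ^ s" by (intro power_increasing) auto
    finally have "real (card ?R) \<le> real (2 ^ s)" by (rule of_nat_mono)
    moreover have "sum f ?R \<le> real (card ?R) * 1"
    proof (rule sum_bounded_above)
      fix F assume "F \<in> ?R"
      then have "F \<subseteq> ?L \<union> ?W" by (simp add: cliques_def)
      then show "f F \<le> 1" unfolding f_def using x0 x1 by (intro prod_le_1) auto
    qed
    ultimately show "sum f ?R \<le> 2 ^ s" unfolding of_nat_power of_nat_numeral by linarith
  qed simp
  ultimately show ?thesis
    unfolding tensor_form_def f_def by (simp add: distrib_left)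
qed

end

subsection \<open>Asymptotics\<close>

text \<open>The derivative of \<open>\<mu> powr (e - 1) * (a + \<mu> * (1 - a))\<close> at \<open>\<mu> = 1\<close> is \<open>e - a\<close>, so a
  limit point \<open>a \<noteq> e\<close> of \<open>p\<close> violates the hypothesis for some \<open>\<mu>\<close> close to \<open>1\<close>.\<close>

lemma tendsto_of_weighted_bound:
  fixes p err :: "nat \<Rightarrow> real" and e :: real
  assumes bound: "\<And>\<mu>. 0 < \<mu> \<Longrightarrow>
      eventually (\<lambda>n. 1 \<le> \<mu> powr (e - 1) * (p n + \<mu> * (1 - p n)) + err n) sequentially"
    and err: "err \<longlonglongrightarrow> 0"
  shows "p \<longlonglongrightarrow> e"
proof -
  define g where "g a \<mu> = \<mu> powr (e - 1) * (a + \<mu> * (1 - a))" for a \<mu> :: real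
  have g1: "g a 1 = 1" for a by (simp add: g_def)
  have deriv: "(g a has_real_derivative (e - a)) (at 1)" for a
    unfolding g_def by (auto intro!: derivative_eq_intros simp: algebra_simps)
  have ev: "eventually (\<lambda>n. g a \<mu> < g (p n) \<mu>) sequentially" if \<mu>: "0 < \<mu>" "g a \<mu> < 1" for a \<mu>
  proof -
    have "eventually (\<lambda>n. err n < 1 - g a \<mu>) sequentially"
      using err \<mu> by (intro order_tendstoD(2)) auto
    with bound[OF \<mu>(1)] show ?thesis
      by eventually_elim (simp add: g_def)
  qed
  \<comment> \<open>\<open>g a \<mu>\<close> is affine in \<open>a\<close>, with slope a positive
    multiple of \<open>1 - \<mu>\<close>. So \<open>\<mu> < 1\<close> yields lower bounds on
    \<open>p n\<close>, and \<open>\<mu> > 1\<close> upper bounds.\<close>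
  have g_less: "g a \<mu> < g a' \<mu> \<longleftrightarrow> a * (1 - \<mu>) < a' * (1 - \<mu>)" if "0 < \<mu>" for a a' \<mu>
  proof -
    have "g a \<mu> < g a' \<mu> \<longleftrightarrow> a + \<mu> * (1 - a) < a' + \<mu> * (1 - a')"
      using that by (simp add: g_def)
    then show ?thesis by (simp add: algebra_simps)
  qed
  show ?thesis
  proof (rule order_tendstoI)
    fix a assume "a < e"
    then obtain d where d: "d > 0" "\<And>h. 0 < h \<Longrightarrow> h < d \<Longrightarrow> g a (1 - h) < g a 1"
      using DERIV_pos_inc_left[OF deriv] by auto
    \<comment> \<open>The cap 1/2 keeps \<open>\<mu> = 1 - h\<close> positive.\<close>
    define h where "h = min (d / 2) (1 / 2)"
    have h: "0 < h" "h < d" "h < 1" using d(1) by (auto simp: h_def min_def)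
    have "eventually (\<lambda>n. g a (1 - h) < g (p n) (1 - h)) sequentially"
      using d(2)[of h] h by (intro ev) (auto simp: g1)
    then show "eventually (\<lambda>n. a < p n) sequentially"
      using h by (simp add: g_less)
  next
    fix a assume "e < a"
    then obtain d where d: "d > 0" "\<And>h. 0 < h \<Longrightarrow> h < d \<Longrightarrow> g a (1 + h) < g a 1"
      using DERIV_neg_dec_right[OF deriv] by auto
    have "eventually (\<lambda>n. g a (1 + d / 2) < g (p n) (1 + d / 2)) sequentially"
      using d(2)[of "d / 2"] d(1) by (intro ev) (auto simp: g1)
    then show "eventually (\<lambda>n. p n < a) sequentially"
      using d(1) by (simp add: g_less)
  qed
qed

context parameters
begin

section \<open>The number of copies, and the passage from \<open>copies n * t\<close> to
  \<open>n\<close>\<close>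

definition copies :: "nat \<Rightarrow> nat" where "copies n = (n + 1 - s) div t"

abbreviation extremal_hypergraph :: "nat \<Rightarrow> (nat + nat \<times> nat) hypergraph" where
  "extremal_hypergraph n \<equiv> clique_hypergraph k (extremal_graph s t n)"

lemma extremal_hypergraph_eq:
  "extremal_hypergraph n =
    (extremal_verts (copies n), cliques extremal_adj (extremal_verts (copies n)) k)"
  unfolding copies_def by (rule clique_hypergraph_extremal_graph)

lemma copies_bounds: "copies n * t \<le> n" "real n - real (s + t) \<le> real (copies n * t)"
proof -
  have "t > 0" using s st by simp
  then have "(n + 1 - s) mod t < t" by simp
  moreover have "copies n * t + (n + 1 - s) mod t = n + 1 - s"
    unfolding copies_def by (rule div_mult_mod_eq)
  ultimately show "copies n * t \<le> n" "real n - real (s + t) \<le> real (copies n * t)"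
    using s by linarith+
qed

lemma copies_ratio: "(\<lambda>n. real (copies n * t) / real n) \<longlonglongrightarrow> 1"
proof (rule tendsto_sandwich)
  show "eventually (\<lambda>n. 1 - real (s + t) / real n \<le> real (copies n * t) / real n) sequentially"
  proof (rule eventually_mono[OF eventually_gt_at_top[of 0]])
    fix n :: nat assume "0 < n"
    then have "1 - real (s + t) / real n = (real n - real (s + t)) / real n"
      by (simp add: diff_divide_distrib)
    also have "\<dots> \<le> real (copies n * t) / real n"
      using copies_bounds(2) by (intro divide_right_mono) auto
    finally show "1 - real (s + t) / real n \<le> real (copies n * t) / real n" .
  qed
  show "eventually (\<lambda>n. real (copies n * t) / real n \<le> 1) sequentially"
  proof (rule eventually_mono[OF eventually_gt_at_top[of 0]])
    fix n :: nat assume "0 < n"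
    then show "real (copies n * t) / real n \<le> 1"
      using of_nat_mono[OF copies_bounds(1), where 'a = real, of n] by (simp del: of_nat_mult)
  qed
  have "(\<lambda>n. 1 - real (s + t) / real n) \<longlonglongrightarrow> 1 - 0"
    by (intro tendsto_intros lim_const_over_n)
  then show "(\<lambda>n. 1 - real (s + t) / real n) \<longlonglongrightarrow> 1" by simp
qed simp

lemma copies_at_top: "filterlim (\<lambda>n. real (copies n * t)) at_top sequentially"
proof (rule filterlim_at_top_mono)
  show "filterlim (\<lambda>n. - real (s + t) + real n) at_top sequentially"
    by (rule filterlim_tendsto_add_at_top[OF tendsto_const filterlim_real_sequentially])
  show "eventually (\<lambda>n. - real (s + t) + real n \<le> real (copies n * t)) sequentially"
    using copies_bounds(2) by (intro always_eventually) (simp add: algebra_simps)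
qed

lemma copies_pos: "eventually (\<lambda>n. 0 < copies n) sequentially"
proof -
  have "eventually (\<lambda>n. 0 < real (copies n * t)) sequentially"
    using copies_at_top by (simp only: filterlim_at_top_dense)
  then show ?thesis by eventually_elim (rule ccontr, simp)
qed

lemma extremal_lower: "eventually (\<lambda>n. c * real (copies n * t) powr e
    \<le> spectral_radius k (extremal_hypergraph n)) sequentially"
  using copies_pos
  by eventually_elim (unfold extremal_hypergraph_eq, rule extremal_lower_bound)

abbreviation max_radius :: "nat \<Rightarrow> real" where
  "max_radius n \<equiv> Max (spectral_radius k `
    (minor_free_class k (complete_bipartite s t) n :: nat hypergraph set))"

lemma extremal_le_max: "eventually (\<lambda>n. spectral_radius k (extremal_hypergraph n) \<le> max_radius n) sequentially"
proof (rule eventually_mono[OF eventually_ge_at_top[of s]])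
  fix n assume "s \<le> n"
  then have "s \<le> n + 1" "0 < k" using k by auto
  then obtain H :: "nat hypergraph" where H: "H \<in> minor_free_class k (complete_bipartite s t) n"
    "spectral_radius k (extremal_hypergraph n) \<le> spectral_radius k H"
    using extremal_in_minor_free_class[OF s st] by blast
  note H(2)
  also have "spectral_radius k H \<le> max_radius n"
    by (rule Max_ge[OF finite_spectral_radius_minor_free_class imageI[OF H(1)]])
  finally show "spectral_radius k (extremal_hypergraph n) \<le> max_radius n" .
qed

lemma max_upper:
  assumes "0 < \<delta>"
  shows "eventually (\<lambda>n. max_radius n \<le> (c + \<delta>) * real n powr e) sequentially"
proof -
  obtain N where N: "\<And>n H. n \<ge> N \<Longrightarrow> H \<in> minor_free_class k (complete_bipartite s t) n \<Longrightarrow>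
      spectral_radius k (H :: nat hypergraph) \<le> (c + \<delta>) * real n powr e"
    using minor_free_upper_bound[OF assms, where ?'a = nat] by blast
  show ?thesis
  proof (rule eventually_mono[OF eventually_ge_at_top[of "max N s"]])
    fix n assume n: "max N s \<le> n"
    then have "s \<le> n + 1" "0 < k" using k by auto
    then have "minor_free_class k (complete_bipartite s t) n \<noteq> ({} :: nat hypergraph set)"
      using extremal_in_minor_free_class[OF s st] by blast
    then show "max_radius n \<le> (c + \<delta>) * real n powr e"
      using N n by (intro Max.boundedI finite_spectral_radius_minor_free_class) auto
  qed
qed

text \<open>Serves both the extremal radius and the maximum. The lower bound is in terms of
  \<open>copies n * t\<close>, the upper one in terms of \<open>n\<close>, and the quotient of these
  tends to 1.\<close>

lemma ratio_tendsto:
  assumes lower: "eventually (\<lambda>n. c * real (copies n * t) powr e \<le> f n) sequentially"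
    and upper: "\<And>\<delta>. 0 < \<delta> \<Longrightarrow> eventually (\<lambda>n. f n \<le> (c + \<delta>) * real n powr e) sequentially"
  shows "(\<lambda>n. f n / real n powr e) \<longlonglongrightarrow> c"
proof (rule order_tendstoI)
  fix a assume a: "a < c"
  have "(\<lambda>n. c * (real (copies n * t) / real n) powr e) \<longlonglongrightarrow> c * 1 powr e"
    by (intro tendsto_intros copies_ratio) simp
  then have "eventually (\<lambda>n. a < c * (real (copies n * t) / real n) powr e) sequentially"
    using a by (intro order_tendstoD(1)) auto
  then show "eventually (\<lambda>n. a < f n / real n powr e) sequentially"
    using lower eventually_gt_at_top[of 0]
  proof eventually_elim
    case (elim n)
    have "c * (real (copies n * t) / real n) powr e = c * real (copies n * t) powr e / real n powr e"
      by (simp only: powr_divide of_nat_0_le_iff times_divide_eq_right)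
    also have "\<dots> \<le> f n / real n powr e"
      using elim(2) by (intro divide_right_mono) auto
    finally show ?case using elim(1) by linarith
  qed
next
  fix a assume a: "c < a"
  then have "eventually (\<lambda>n. f n \<le> (c + (a - c) / 2) * real n powr e) sequentially"
    by (intro upper) simp
  then show "eventually (\<lambda>n. f n / real n powr e < a) sequentially"
    using eventually_gt_at_top[of 0]
  proof eventually_elim
    case (elim n)
    have "f n / real n powr e \<le> c + (a - c) / 2"
      using elim by (simp add: pos_divide_le_eq)
    also have "\<dots> < a" using a by (simp add: field_simps)
    finally show ?case .
  qed
qed

lemma extremal_ratio: "(\<lambda>n. spectral_radius k (extremal_hypergraph n) / real n powr e) \<longlonglongrightarrow> c"
proof (rule ratio_tendsto[OF extremal_lower])
  fix \<delta> :: real assume "0 < \<delta>"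
  from max_upper[OF this] extremal_le_max
  show "eventually (\<lambda>n. spectral_radius k (extremal_hypergraph n) \<le> (c + \<delta>) * real n powr e) sequentially"
    by eventually_elim simp
qed

lemma max_ratio: "(\<lambda>n. max_radius n / real n powr e) \<longlonglongrightarrow> c"
proof (rule ratio_tendsto[OF _ max_upper])
  from extremal_lower extremal_le_max
  show "eventually (\<lambda>n. c * real (copies n * t) powr e \<le> max_radius n) sequentially"
    by eventually_elim simp
qed

lemma max_asymp_equiv: "max_radius \<sim>[sequentially] (\<lambda>n. spectral_radius k (extremal_hypergraph n))"
proof (rule asymp_equivI')
  have "(\<lambda>n. (max_radius n / real n powr e) / (spectral_radius k (extremal_hypergraph n) / real n powr e))
      \<longlonglongrightarrow> c / c"
    using c_pos by (intro tendsto_divide max_ratio extremal_ratio) simp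
  then have *: "(\<lambda>n. (max_radius n / real n powr e) / (spectral_radius k (extremal_hypergraph n) / real n powr e))
      \<longlonglongrightarrow> 1"
    using c_pos by simp
  show "(\<lambda>n. max_radius n / spectral_radius k (extremal_hypergraph n)) \<longlonglongrightarrow> 1"
  proof (rule Lim_transform_eventually[OF *])
    show "eventually (\<lambda>n. (max_radius n / real n powr e) / (spectral_radius k (extremal_hypergraph n) / real n powr e)
        = max_radius n / spectral_radius k (extremal_hypergraph n)) sequentially"
      using eventually_gt_at_top[of 0] by eventually_elim simp
  qed
qed

text \<open>A Perron vector does at least as well as the test vector of
  \<open>extremal_lower_bound\<close>. Dividing \<open>extremal_upper_bound\<close> by that value
  gives, for every \<open>\<mu>\<close>, the hypothesis of
  \<open>tendsto_of_weighted_bound\<close>.\<close>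

lemma perron_mass:
  assumes perron: "\<And>n. perron_vector k (extremal_hypergraph n) (x n)"
  shows "(\<lambda>n. \<Sum>u\<in>dominating s. x n u ^ k) \<longlonglongrightarrow> e"
proof (rule tendsto_of_weighted_bound)
  define N where "N n = real (copies n * t)" for n
  \<comment> \<open>The two lower-order terms of \<open>extremal_upper_bound\<close>, divided by
    \<open>c * N n powr e\<close>.\<close>
  define err where "err n = 2 ^ (s + t) / c * N n powr - (1 / k) + real k * 2 ^ s / c * N n powr - e" for n
  have N: "filterlim N at_top sequentially" unfolding N_def by (rule copies_at_top)
  have "err \<longlonglongrightarrow> 2 ^ (s + t) / c * 0 + real k * 2 ^ s / c * 0"
    unfolding err_def using k e_pos by (intro tendsto_intros tendsto_neg_powr N) auto
  then show "err \<longlonglongrightarrow> 0" by simp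
  fix \<mu> :: real assume \<mu>: "0 < \<mu>"
  from copies_pos
  show "eventually (\<lambda>n. 1 \<le> \<mu> powr (e - 1) * ((\<Sum>u\<in>dominating s. x n u ^ k)
      + \<mu> * (1 - (\<Sum>u\<in>dominating s. x n u ^ k))) + err n) sequentially"
  proof eventually_elim
    case (elim n)
    let ?p = "\<Sum>u\<in>dominating s. x n u ^ k"
    let ?H = "(extremal_verts (copies n), cliques extremal_adj (extremal_verts (copies n)) k)"
    have Npos: "0 < N n" using elim s st by (simp add: N_def)
    then have pos: "0 < c * N n powr e" using c_pos by simp
    have px: "perron_vector k ?H (x n)"
      using perron[of n] unfolding extremal_hypergraph_eq .
    then have "unit_vector k ?H (x n)" by (simp add: perron_vector_def is_arg_max_def)
    then have "tensor_form k ?H (x n) \<le> c * N n powr e * (\<mu> powr (e - 1) * (?p + \<mu> * (1 - ?p)))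
        + 2 ^ (s + t) * N n powr (e - 1 / k) + real k * 2 ^ s"
      unfolding N_def by (rule extremal_upper_bound[OF elim \<mu>])
    moreover have "c * N n powr e \<le> tensor_form k ?H (x n)"
      using extremal_lower_bound[OF elim] spectral_radius_perron_vector[OF px] by (simp only: N_def)
    moreover have "2 ^ (s + t) * N n powr (e - 1 / k) + real k * 2 ^ s = c * N n powr e * err n"
      using c_pos Npos by (simp add: err_def field_simps powr_add[symmetric] powr_minus powr_diff)
    ultimately have "c * N n powr e * 1
        \<le> c * N n powr e * (\<mu> powr (e - 1) * (?p + \<mu> * (1 - ?p)) + err n)"
      by (simp add: distrib_left)
    then show ?case using pos by (simp only: mult_le_cancel_left_pos)
  qed
qed

end

theorem theorem1p2:
  fixes k s t :: nat and j :: int and c e :: real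
  assumes k: "3 \<le> k" and s: "2 \<le> s" and st: "s \<le> t"
    and j: "j = int k - int s + 1" and tj: "int t \<ge> j"
    and e: "e = real (min (s - 1) (k - 1)) / real k"
    and c: "c = (if j \<le> 1
                 then real ((s - 1) choose (k - 1)) *
                        (real (k - 1) / real (s - 1)) powr (real (k - 1) / real k)
                 else 1 / real t * real (t choose nat j) * real_of_int j powr (real_of_int j / real k))"
  shows "(\<lambda>n. spectral_radius k (clique_hypergraph k (extremal_graph s t n)) / real n powr e)
           \<longlonglongrightarrow> c \<and>
         (\<lambda>n. Max (spectral_radius k `
                  (minor_free_class k (complete_bipartite s t) n :: nat hypergraph set)))
           \<sim>[sequentially]
         (\<lambda>n. spectral_radius k (clique_hypergraph k (extremal_graph s t n))) \<and>
         (\<forall>x :: nat \<Rightarrow> nat + nat \<times> nat \<Rightarrow> real.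
            (\<forall>n. perron_vector k (clique_hypergraph k (extremal_graph s t n)) (x n)) \<longrightarrow>
            (\<lambda>n. \<Sum>u\<in>Inl ` {..<s - 1}. x n u ^ k) \<longlonglongrightarrow> e)"
proof -
  interpret P: parameters k s t
    using k s st j tj by unfold_locales auto
  have e_eq: "e = P.e"
    using e k s by (auto simp: P.e_def P.r_def min_def)
  have c_eq: "c = P.c"
  proof (cases "j \<le> 1")
    case True
    then have "P.r = k" "P.m = 1" using j by (auto simp: P.m_def P.r_def)
    then show ?thesis
      using c True by (simp add: P.c_def P.\<Delta>_def P.\<gamma>_def P.e_def)
  next
    case False
    then have rm: "P.r = s" "P.m = nat j" "real P.m = real_of_int j" using j by (auto simp: P.m_def P.r_def)
    have "P.m * (t choose P.m) = t * ((t - 1) choose (P.m - 1))"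
      using P.m_bounds by (intro times_binomial_minus1_eq) simp
    then have "real (P.m * (t choose P.m)) = real (t * ((t - 1) choose (P.m - 1)))"
      by (rule arg_cong)
    then have \<Delta>: "real P.\<Delta> = 1 / real t * real (t choose P.m) * real P.m"
      using s st rm(1) by (simp add: P.\<Delta>_def field_simps)
    \<comment> \<open>With \<open>r = s\<close> the fraction in \<open>\<gamma>\<close> collapses,
      and the factor \<open>m\<close> of \<open>\<Delta>\<close> combines with
      \<open>\<gamma> powr e\<close> to the exponent \<open>1 - e = m / k\<close>.\<close>
    have "P.\<gamma> = 1 / real P.m"
      using s by (simp add: P.\<gamma>_def rm(1))
    then have "P.\<gamma> powr P.e = real P.m powr - P.e"
      by (simp add: powr_divide powr_minus_divide)
    then have "real P.m * P.\<gamma> powr P.e = real P.m powr (1 + - P.e)"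
      by (simp only: powr_add) simp
    then have "real P.m * P.\<gamma> powr P.e = real P.m powr (real P.m / k)"
      by (simp add: P.e_eq)
    then have "P.c = 1 / real t * real (t choose P.m) * real P.m powr (real P.m / k)"
      by (simp add: P.c_def \<Delta>)
    then show ?thesis using c False rm by simp
  qed
  show ?thesis
    unfolding e_eq c_eq using P.extremal_ratio P.max_asymp_equiv P.perron_mass by blast
qed

end
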